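(* For each integer $m\ge0$, the $m$th derivatives of the functions $G$ and $F$ satisfy \[ G^{(m)}(x)\sim 2F^{(m)}(x), \] as $x\to0$ (with $x>0$ real).
   Context: Let $Q_n=\prod_{1\le \ell\le n}(1-2^{-\ell})$ (so $Q_0=1$) and $Q_\infty=\prod_{\ell\ge1}(1-2^{-\ell})$. The functions are defined for $x>0$ by \[ F(x)=\sum_{j\ge 0}\frac{(-1)^j 2^{-\binom{j}{2}}}{Q_jQ_\infty}\,e^{-2^jx}, \] \[ G(x)=\sum_{j,r\ge0}\ \sum_{0\le h,\ell\le j}\frac{(-1)^{r+h+\ell}\,2^{-j-\binom r2-\binom h2-\binom \ell2+2h+2\ell}}{Q_\infty Q_rQ_hQ_{j-h}Q_\ell Q_{j-\ell}}\,\varphi(2^{j+r},2^h+2^\ell;x), \] where $\varphi(u,v;x)=e^{-vx}\int_0^x(x-t)e^{-(u-v)t}\,\mathrm{d}t$. *)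

theory Defs
  imports "HOL-Analysis.Analysis" "HOL-Library.Landau_Symbols"
begin

definition Q :: "nat \<Rightarrow> real" where
  "Q n = (\<Prod>l=1..n. 1 - 2 powr (- real l))"

text \<open>The index is shifted by one because \<^const>\<open>prodinf\<close> starts at \<open>0\<close>.\<close>
definition Q_inf :: real where
  "Q_inf = prodinf (\<lambda>l. 1 - 2 powr (- real (Suc l)))"

definition F :: "real \<Rightarrow> real" where
  "F x = (\<Sum>j. (- 1) ^ j * 2 powr (- real (j choose 2)) / (Q j * Q_inf) * exp (- (2 ^ j) * x))"

definition phi :: "real \<Rightarrow> real \<Rightarrow> real \<Rightarrow> real" where
  "phi u v x = exp (- v * x) * integral {0..x} (\<lambda>t. (x - t) * exp (- (u - v) * t))"

text \<open>The double series over \<open>j\<close> and \<open>r\<close> converges absolutely for \<open>x > 0\<close>: the summand is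
  \<open>O(2\<^sup>-\<^sup>j 2 powr (- (r choose 2)))\<close> after summing over \<open>h\<close> and \<open>l\<close>, since
  \<open>0 \<le> phi u v x \<le> x\<^sup>2 / 2\<close> for \<open>u, v \<ge> 0\<close>. It is therefore written as an unordered
  sum.\<close>
definition G :: "real \<Rightarrow> real" where
  "G x = (\<Sum>\<^sub>\<infinity>(j, r)\<in>UNIV. \<Sum>h\<le>j. \<Sum>l\<le>j.
     (- 1) ^ (r + h + l)
     * 2 powr (- real j - real (r choose 2) - real (h choose 2) - real (l choose 2)
                + 2 * real h + 2 * real l)
     / (Q_inf * Q r * Q h * Q (j - h) * Q l * Q (j - l))
     * phi (2 ^ (j + r)) (2 ^ h + 2 ^ l) x)"

end

theory Submission
  imports Defs "HOL-Computational_Algebra.Polynomial"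
begin

text \<open>
  Let \<open>E\<^sub>0, E\<^sub>1, \<dots>\<close> be independent standard exponential variables. The function \<open>F\<close> is the density of
  \<open>\<Sum>\<^sub>i E\<^sub>i / 2\<^sup>i\<close>: its Laplace transform is \<open>\<Prod>\<^sub>i 1 / (1 + s / 2\<^sup>i)\<close>. Write \<open>g\<^sub>j\<close> for the density of
  \<open>\<Sum>\<^sub>i\<^sub>\<le>\<^sub>j E\<^sub>i / 2\<^sup>i\<close> and \<open>K\<^sub>j\<close> for that of \<open>\<Sum>\<^sub>i\<^sub>\<ge>\<^sub>j E\<^sub>i / 2\<^sup>i\<close>, so that \<open>K\<^sub>j x = 2\<^sup>j F (2\<^sup>j x)\<close>.
  Summing over \<open>r\<close>, \<open>h\<close> and \<open>l\<close> in the definition of \<open>G\<close> gives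
  \<open>G = \<Sum>\<^sub>j 4 powr (- j) \<cdot> (K\<^sub>j * u\<^sub>j)\<close> with \<open>u\<^sub>j t = t (g\<^sub>j'' t)\<^sup>2\<close> and \<open>*\<close> the convolution on \<open>[0, x]\<close>.

  The functional equation \<open>F' x = 2 F (2 x) - F x\<close> says that \<open>K\<^sub>i\<^sub>+\<^sub>1 = (1 + D / 2\<^sup>i) K\<^sub>i\<close>, where \<open>D\<close> is
  differentiation. Integration by parts moves the operators \<open>1 + D / 2\<^sup>i\<close>, \<open>i < j\<close>, from
  \<open>K\<^sub>j\<close> to \<open>u\<^sub>j\<close> and leaves \<open>K\<^sub>0 = F\<close>. Because \<open>g\<^sub>j\<close> vanishes to order \<open>j\<close> at the origin,
  \<open>u\<^sub>j\<close> vanishes there to order \<open>2 j - 3\<close>, and the only boundary term that survives comes from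
  \<open>j = 2\<close>. Its value is exactly \<open>2 F x\<close>: this is the constant \<open>2\<close> of the theorem. Hence
  \<open>G = 2 F + \<Sum>\<^sub>j F * R\<^sub>j\<close> with \<open>R\<^sub>j = 4 powr (- j) \<cdot> \<Prod>\<^sub>i\<^sub><\<^sub>j (1 + D / 2\<^sup>i) u\<^sub>j\<close> (lemmas
  \<open>convolution_shift\<close>, \<open>suminf_G_term\<close>, \<open>G_eq\<close>).

  On \<open>e\<^sup>-\<^sup>v\<^sup>t\<close> the operator acts as multiplication by \<open>\<Prod>\<^sub>i\<^sub><\<^sub>j (1 - v / 2\<^sup>i)\<close>, and for
  \<open>v = 2\<^sup>h + 2\<^sup>l\<close> the growth of this product is compensated by the Gaussian-type decay of the
  coefficients; thus the \<open>L\<^sup>1\<close> norms of the \<open>R\<^sub>j\<close> are \<open>O((j + 1)\<^sup>3 / 2\<^sup>j)\<close> (lemma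
  \<open>integral_abs_kernel_le\<close>).

  Extended by zero, \<open>F\<close> is smooth on the whole line, so derivatives fall on \<open>F\<close> inside the convolution.
  Each derivative of \<open>F\<close> is nonnegative and increasing on some interval \<open>(0, \<delta>)\<close> (lemma \<open>F_ext_mono_near_0\<close>),
  so that \<open>\<bar>(F * R\<^sub>j)\<^sup>(\<^sup>m\<^sup>) x\<bar> \<le> F\<^sup>(\<^sup>m\<^sup>) x \<cdot> \<integral>\<^sub>0\<^sup>x \<bar>R\<^sub>j\<bar>\<close>, and the sum of these integrals over
  \<open>j\<close> tends to \<open>0\<close> with \<open>x\<close>.
\<close>

section \<open>Partial products of Q and the exponential coefficients\<close>

lemma Q_eq: "Q n = (\<Prod>l=1..n. 1 - 1 / 2 ^ l)"
  unfolding Q_def by (intro prod.cong refl) (simp add: powr_minus powr_realpow divide_simps)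

lemma Q_0 [simp]: "Q 0 = 1"
  by (simp add: Q_def)

lemma Q_Suc: "Q (Suc n) = Q n * (1 - 1 / 2 ^ Suc n)"
  by (simp add: Q_eq)

lemma Q_pos: "Q n > 0"
  unfolding Q_eq by (intro prod_pos) auto

lemma Q_limit: "Q \<longlonglongrightarrow> Q_inf"
  and Q_inf_pos: "Q_inf > 0"
proof -
  let ?f = "\<lambda>l. 1 - 1 / 2 ^ Suc l :: real"
  have Q_inf: "Q_inf = prodinf ?f"
    unfolding Q_inf_def
    by (intro arg_cong[where f = prodinf] ext, subst powr_minus, subst powr_realpow)
       (auto simp: divide_simps)
  have pos: "?f l > 0" for l
    using one_less_power[of "2::real" "Suc l"] by (simp add: field_simps del: power_Suc)
  have "summable (\<lambda>l. (1/2) ^ l * (1/2) :: real)"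
    by (intro summable_mult2 summable_geometric) auto
  then have "summable (\<lambda>l. \<bar>- (1 / 2 ^ Suc l) :: real\<bar>)"
    by (simp add: field_simps)
  then have conv: "convergent_prod (\<lambda>l. 1 + - (1 / 2 ^ Suc l) :: real)"
  proof (rule summable_imp_convergent_prod_real)
    show "- (1 / 2 ^ Suc l) \<noteq> (-1::real)" for l using pos[of l] by simp
  qed
  then have conv: "convergent_prod ?f" by simp
  have "?f l \<noteq> 0" for l using less_imp_neq[OF pos[of l]] by (rule not_sym)
  with conv have "prodinf ?f \<noteq> 0" by (rule prodinf_nonzero)
  have "(\<lambda>n. \<Prod>i\<le>n. ?f i) \<longlonglongrightarrow> Q_inf"
    unfolding Q_inf using conv by (rule convergent_prod_LIMSEQ)
  moreover have "(\<Prod>i\<le>n. ?f i) = Q (Suc n)" for n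
    by (induction n) (simp_all add: Q_Suc)
  ultimately have "(\<lambda>n. Q (Suc n)) \<longlonglongrightarrow> Q_inf" by simp
  then show lim: "Q \<longlonglongrightarrow> Q_inf" by (rule LIMSEQ_imp_Suc)
  have "Q_inf \<ge> 0"
    using lim by (rule LIMSEQ_le_const) (use Q_pos less_imp_le in blast)
  with \<open>prodinf ?f \<noteq> 0\<close> show "Q_inf > 0" unfolding Q_inf by linarith
qed

lemma Q_ge: "Q_inf \<le> Q n"
proof -
  have "Q (Suc n) \<le> Q n" for n
    unfolding Q_Suc using Q_pos[of n] by (intro mult_left_le) auto
  then have "decseq Q" by (rule decseq_SucI)
  then show ?thesis using Q_limit by (rule decseq_ge)
qed

lemma Q_nonzero [simp]: "Q n \<noteq> 0" "Q_inf \<noteq> 0"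
  using Q_pos[of n] Q_inf_pos by auto

text \<open>
  The coefficient of \<open>e\<^sup>-\<^sup>v\<^sup>x\<close>, \<open>v = 2\<^sup>h\<close>, in the density \<open>g\<^sub>j\<close> of \<open>\<Sum>\<^sub>i\<^sub>\<le>\<^sub>j E\<^sub>i / 2\<^sup>i\<close>, obtained from
  the partial fractions of \<open>\<Prod>\<^sub>i\<^sub>\<le>\<^sub>j 1 / (1 + s / 2\<^sup>i)\<close>.
\<close>

definition hypoexp_coeff :: "nat \<Rightarrow> nat \<Rightarrow> real" where
  "hypoexp_coeff j h = (- 1) ^ h / (2 ^ (h choose 2) * Q h * Q (j - h))"

definition F_coeff :: "nat \<Rightarrow> real" where
  "F_coeff r = (- 1) ^ r / (2 ^ (r choose 2) * Q r * Q_inf)"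

lemma inverse_Q_le:
  "1 / (2 ^ k * Q h * Q i) \<le> 1 / Q_inf ^ 2 / 2 ^ k"
  "1 / (2 ^ k * Q h * Q_inf) \<le> 1 / Q_inf ^ 2 / 2 ^ k"
proof -
  have *: "1 / (2 ^ k * y) \<le> 1 / Q_inf ^ 2 / 2 ^ k" if "Q_inf * Q_inf \<le> y" for y
  proof -
    have "1 / y \<le> 1 / Q_inf ^ 2"
      unfolding power2_eq_square using that Q_inf_pos by (intro frac_le) auto
    then have "1 / y / 2 ^ k \<le> 1 / Q_inf ^ 2 / 2 ^ k" by (rule divide_right_mono) simp
    then show ?thesis by (simp add: mult.commute)
  qed
  show "1 / (2 ^ k * Q h * Q i) \<le> 1 / Q_inf ^ 2 / 2 ^ k"
    unfolding mult.assoc using Q_ge[of h] Q_ge[of i] Q_inf_pos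
    by (intro * mult_mono) (auto intro: order.trans less_imp_le[OF Q_pos])
  show "1 / (2 ^ k * Q h * Q_inf) \<le> 1 / Q_inf ^ 2 / 2 ^ k"
    unfolding mult.assoc using Q_ge[of h] Q_inf_pos
    by (intro * mult_mono) (auto intro: less_imp_le[OF Q_pos])
qed

lemma hypoexp_coeff_bound: "\<bar>hypoexp_coeff j h\<bar> \<le> 1 / Q_inf ^ 2 / 2 ^ (h choose 2)"
  using inverse_Q_le(1)[of "h choose 2" h "j - h"] Q_pos[of h] Q_pos[of "j - h"]
  by (simp add: hypoexp_coeff_def abs_mult power_abs)

lemma F_coeff_bound: "\<bar>F_coeff r\<bar> \<le> 1 / Q_inf ^ 2 / 2 ^ (r choose 2)"
  using inverse_Q_le(2)[of "r choose 2" r] Q_pos[of r] Q_inf_pos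
  by (simp add: F_coeff_def abs_mult power_abs)

lemma choose_two_Suc: "Suc n choose 2 = (n choose 2) + n"
  by (simp add: numeral_2_eq_2)

lemma summable_choose_two: "summable (\<lambda>r. C / 2 ^ (r choose 2) :: real)"
proof -
  have le: "r \<le> Suc (r choose 2)" for r
    by (cases r) (simp_all add: choose_two_Suc)
  have "2 ^ r \<le> 2 * (2::real) ^ (r choose 2)" for r
    using power_increasing[OF le, of "2::real" r] by simp
  then have "1 / 2 ^ (r choose 2) \<le> 2 * (1/2 :: real) ^ r" for r :: nat
    by (simp add: field_simps)
  then have "summable (\<lambda>r. 1 / 2 ^ (r choose 2) :: real)"
    by (intro summable_comparison_test'[OF summable_mult[OF summable_geometric], of "1/2" 0 _ 2])
       auto
  from summable_mult[OF this, of C] show ?thesis by simp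
qed

lemma summable_F_coeff: "summable (\<lambda>r. \<bar>F_coeff r\<bar>)"
  by (rule summable_comparison_test'[OF summable_choose_two[of "1 / Q_inf ^ 2"], of 0])
     (use F_coeff_bound in auto)

text \<open>
  Coefficient form of \<open>(1 + D / 2 ^ (j + 1)) g\<^sub>j\<^sub>+\<^sub>1 = g\<^sub>j\<close>. For \<open>h = j + 1\<close> the factor is zero, which
  is why the extra exponential of \<open>g\<^sub>j\<^sub>+\<^sub>1\<close> disappears.
\<close>

lemma hypoexp_coeff_Suc:
  "h \<le> j \<Longrightarrow> hypoexp_coeff (Suc j) h * (1 - 2 ^ h / 2 ^ Suc j) = hypoexp_coeff j h"
proof -
  assume "h \<le> j"
  then have S: "Suc j - h = Suc (j - h)" and p: "(2::real) ^ Suc j = 2 ^ Suc (j - h) * 2 ^ h"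
    by (auto simp flip: power_add)
  have "1 - 1 / 2 ^ Suc (j - h) \<noteq> (0::real)"
    using Q_nonzero(1)[of "Suc (j - h)"] unfolding Q_Suc by auto
  then show ?thesis
    unfolding hypoexp_coeff_def S Q_Suc p by (simp del: power_Suc)
qed

text \<open>
  Coefficient form of the functional equation \<open>F x + F' x = 2 F (2 x)\<close>.
\<close>

lemma F_coeff_Suc: "F_coeff (Suc r) * (1 - 2 ^ Suc r) = 2 * F_coeff r"
proof -
  have "1 - 1 / 2 ^ Suc r \<noteq> (0::real)"
    using Q_nonzero(1)[of "Suc r"] unfolding Q_Suc by auto
  moreover have "(1 - 2 ^ Suc r :: real) = - (2 ^ Suc r) * (1 - 1 / 2 ^ Suc r)"
    by (simp add: field_simps)
  ultimately show ?thesis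
    unfolding F_coeff_def Q_Suc choose_two_Suc power_add
    by (simp add: field_simps)
qed

text \<open>
  The alternating sum in the \<open>q\<close>-binomial theorem (\<open>q = 1/2\<close>) telescopes; the closed form of the partial sums makes
  the full sum, with one more term, equal to zero.
\<close>

lemma sum_hypoexp_coeff_atMost:
  "n \<le> j \<Longrightarrow> (\<Sum>h\<le>n. hypoexp_coeff (Suc j) h) =
     (- 1) ^ n / (2 ^ (Suc n choose 2) * Q n * Q (j - n) * (1 - 1 / 2 ^ Suc j))"
proof (induction n)
  case 0
  have "1 - 1 / 2 ^ Suc j \<noteq> (0::real)"
    using Q_nonzero(1)[of "Suc j"] unfolding Q_Suc by auto
  then show ?case by (simp add: hypoexp_coeff_def Q_Suc choose_two_Suc numeral_2_eq_2)
next
  case (Suc n)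
  define i where "i = j - Suc n"
  have j: "j = Suc n + i" using Suc.prems by (simp add: i_def)
  \<comment> \<open>With \<open>x = q\<^sup>n\<^sup>+\<^sup>1\<close> and \<open>y = q\<^sup>j\<^sup>-\<^sup>n\<close> the step is \<open>(1 - x) - (1 - x y) = - x (1 - y)\<close>.\<close>
  define x where "x = 1 / (2::real) ^ Suc n" define y where "y = 1 / (2::real) ^ Suc i"
  have S: "j - n = Suc i" "Suc j - Suc n = Suc i" "j - Suc n = i" by (auto simp: j)
  have xy: "1 / 2 ^ Suc j = x * y" by (simp add: x_def y_def j power_add)
  have nz: "1 - x \<noteq> 0" "1 - y \<noteq> 0" "1 - x * y \<noteq> 0"
    using Q_nonzero(1)[of "Suc n"] Q_nonzero(1)[of "Suc i"] Q_nonzero(1)[of "Suc j"]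
    unfolding Q_Suc xy x_def y_def by auto
  have two_power: "(2::real) ^ (Suc (Suc n) choose 2) = 2 ^ (Suc n choose 2) / x"
    by (simp add: choose_two_Suc power_add x_def)
  have x0: "x \<noteq> 0" by (simp add: x_def)
  define p where "p = (2::real) ^ (Suc n choose 2)"
  have p0: "p \<noteq> 0" by (simp add: p_def)
  have "(\<Sum>h\<le>Suc n. hypoexp_coeff (Suc j) h) =
     (- 1) ^ n / (p * Q n * (Q i * (1 - y)) * (1 - x * y))
     + (- 1) ^ Suc n / (p * (Q n * (1 - x)) * (Q i * (1 - y)))"
    using Suc unfolding sum.atMost_Suc
    by (simp add: S xy hypoexp_coeff_def Q_Suc flip: x_def y_def p_def del: power_Suc sum.atMost_Suc)
  also have "\<dots> = (- 1) ^ Suc n / (p / x * (Q n * (1 - x)) * Q i * (1 - x * y))"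
  proof -
    have "s / (p * u * (w * b) * c) + - s / (p * (u * a) * (w * b))
        = - s / (p / x * (u * a) * w * c)"
      if "a \<noteq> 0" "b \<noteq> 0" "c \<noteq> 0" "c - a = x * b" for a b c s u w :: real
    proof -
      have "1 / (b * c) - 1 / (a * b) = (a - c) / (a * b * c)"
        using that(1-3) by (simp add: field_simps)
      also have "a - c = - x * b" using that(4) by simp
      finally have "1 / (b * c) - 1 / (a * b) = - x / (a * c)" using that(2) by simp
      then have "s / (p * u * w) * (1 / (b * c) - 1 / (a * b)) = s / (p * u * w) * (- x / (a * c))"
        by (rule arg_cong)
      then show ?thesis by (simp add: right_diff_distrib mult_ac)
    qed
    moreover have "1 - x * y - (1 - x) = x * (1 - y)" by (simp add: algebra_simps)
    ultimately show ?thesis using nz by (simp only: power_Suc mult_minus1)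
  qed
  finally show ?case
    unfolding S(3) xy Q_Suc x_def[symmetric] two_power p_def .
qed

text \<open>
  Up to the sign \<open>(-1)\<^sup>k\<close> this is the \<open>k\<close>-th derivative of \<open>g\<^sub>j\<close> at the origin.
\<close>

definition hypoexp_moment :: "nat \<Rightarrow> nat \<Rightarrow> real" where
  "hypoexp_moment j k = (\<Sum>h\<le>j. hypoexp_coeff j h * (2 ^ h) ^ k)"

lemma hypoexp_moment_Suc_0: "hypoexp_moment (Suc j) 0 = 0"
  using sum_hypoexp_coeff_atMost[of j j]
  by (simp add: hypoexp_moment_def hypoexp_coeff_def Q_Suc)

lemma hypoexp_moment_Suc_Suc:
  "hypoexp_moment (Suc j) (Suc k) = 2 ^ Suc j * (hypoexp_moment (Suc j) k - hypoexp_moment j k)"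
proof -
  let ?c = "hypoexp_coeff (Suc j)"
  have "hypoexp_moment (Suc j) k - hypoexp_moment (Suc j) (Suc k) / 2 ^ Suc j
      = (\<Sum>h\<le>Suc j. ?c h * (1 - 2 ^ h / 2 ^ Suc j) * (2 ^ h) ^ k)"
    unfolding hypoexp_moment_def sum_divide_distrib sum_subtractf[symmetric]
    by (intro sum.cong refl) (simp add: field_simps)
  also have "\<dots> = (\<Sum>h\<le>j. ?c h * (1 - 2 ^ h / 2 ^ Suc j) * (2 ^ h) ^ k)"
    by (subst sum.atMost_Suc) simp
  also have "\<dots> = hypoexp_moment j k"
    unfolding hypoexp_moment_def by (intro sum.cong refl) (metis atMost_iff hypoexp_coeff_Suc)
  finally show ?thesis by (simp add: field_simps)
qed

text \<open>
  The density of a sum of \<open>j + 1\<close> independent exponentials vanishes to order \<open>j\<close> at the origin.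
\<close>

lemma hypoexp_moment_eq_0: "k < j \<Longrightarrow> hypoexp_moment j k = 0"
proof (induction k arbitrary: j)
  case 0
  then show ?case by (cases j) (auto simp: hypoexp_moment_Suc_0)
next
  case (Suc k)
  then show ?case by (cases j) (auto simp: hypoexp_moment_Suc_Suc)
qed

text \<open>
  The value \<open>g\<^sub>2'' 0 = 2\<^sup>0 \<cdot> 2\<^sup>1 \<cdot> 2\<^sup>2\<close>, the product of the three rates; it determines the constant \<open>2\<close> in the
  asymptotic relation.
\<close>

lemma hypoexp_moment_2_2: "hypoexp_moment 2 2 = 8"
proof -
  have "hypoexp_moment 0 k = 1" for k
    by (simp add: hypoexp_moment_def hypoexp_coeff_def binomial_eq_0)
  then show ?thesis
    by (simp add: numeral_2_eq_2 hypoexp_moment_Suc_Suc hypoexp_moment_eq_0)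
qed

section \<open>The density F and its derivatives near the origin\<close>

lemma F_eq: "F x = (\<Sum>j. F_coeff j * exp (- (2 ^ j) * x))"
  unfolding F_def F_coeff_def
  by (intro suminf_cong) (simp add: powr_minus powr_realpow divide_simps)

lemma abs_mult_exp_le: "0 \<le> v \<Longrightarrow> 0 \<le> x \<Longrightarrow> \<bar>c * exp (- v * x)\<bar> \<le> \<bar>c :: real\<bar>"
  by (simp add: abs_mult mult_left_le)

lemma summable_F_term: "0 \<le> x \<Longrightarrow> summable (\<lambda>j. F_coeff j * exp (- (2 ^ j) * x))"
  by (rule summable_comparison_test'[OF summable_F_coeff, of 0])
     (metis abs_mult_exp_le real_norm_def zero_le_numeral zero_le_power)

lemma F_bounded: obtains B where "\<And>x. 0 \<le> x \<Longrightarrow> \<bar>F x\<bar> \<le> B"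
proof
  fix x :: real assume x: "0 \<le> x"
  have "norm (\<Sum>j. F_coeff j * exp (- (2 ^ j) * x)) \<le> (\<Sum>j. \<bar>F_coeff j\<bar>)"
    using abs_mult_exp_le[OF _ x] by (intro norm_suminf_le summable_F_coeff) auto
  then show "\<bar>F x\<bar> \<le> (\<Sum>j. \<bar>F_coeff j\<bar>)" by (simp add: F_eq)
qed

lemma continuous_on_F: "continuous_on {0..} F"
proof -
  have "uniform_limit {0..} (\<lambda>n x. \<Sum>j<n. F_coeff j * exp (- (2 ^ j) * x))
          (\<lambda>x. \<Sum>j. F_coeff j * exp (- (2 ^ j) * x)) sequentially"
    using abs_mult_exp_le by (intro Weierstrass_m_test[OF _ summable_F_coeff]) auto
  then have "continuous_on {0..} (\<lambda>x. \<Sum>j. F_coeff j * exp (- (2 ^ j) * x))"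
    by (rule uniform_limit_theorem[rotated]) (auto intro!: always_eventually continuous_intros)
  then show ?thesis by (simp add: F_eq[abs_def])
qed

text \<open>
  The differentiated series is dominated uniformly on \<open>[0, \<infinity>)\<close>, because the recurrence for the coefficients turns
  \<open>2\<^sup>j\<close> times a coefficient into a combination of two neighbouring coefficients. The same recurrence identifies its sum.
\<close>

lemma F_has_derivative:
  assumes "0 < x"
  shows "(F has_real_derivative 2 * F (2 * x) - F x) (at x)"
proof -
  let ?M = "\<lambda>j. \<bar>F_coeff j * - (2 ^ j)\<bar>"
  have le: "?M (Suc j) \<le> \<bar>F_coeff (Suc j)\<bar> + 2 * \<bar>F_coeff j\<bar>" for j
    using F_coeff_Suc[of j] unfolding right_diff_distrib by linarith
  have summable_le: "summable (\<lambda>j. \<bar>F_coeff (Suc j)\<bar> + 2 * \<bar>F_coeff j\<bar>)"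
    by (rule summable_add[OF _ summable_mult[OF summable_F_coeff]])
       (subst summable_Suc_iff, rule summable_F_coeff)
  have "summable (\<lambda>j. ?M (Suc j))"
    by (rule summable_comparison_test'[OF summable_le, of 0])
       (unfold real_norm_def abs_idempotent, rule le)
  then have summable_M: "summable ?M" by (rule summable_Suc_iff[THEN iffD1])
  have uniform: "uniformly_convergent_on {0..}
      (\<lambda>n x. \<Sum>j<n. F_coeff j * - (2 ^ j) * exp (- (2 ^ j) * x))"
  proof (rule Weierstrass_m_test'[OF _ summable_M])
    show "norm (F_coeff j * - (2 ^ j) * exp (- (2 ^ j) * x)) \<le> ?M j" if "x \<in> {0..}"
      for j and x :: real
      unfolding real_norm_def using that by (intro abs_mult_exp_le) auto
  qed
  have deriv: "((\<lambda>x. F_coeff j * exp (- (2 ^ j) * x)) has_real_derivative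
      F_coeff j * - (2 ^ j) * exp (- (2 ^ j) * y)) (at y within {0..})" for j y
    by (auto intro!: derivative_eq_intros)
  have "((\<lambda>x. \<Sum>j. F_coeff j * exp (- (2 ^ j) * x)) has_real_derivative
      (\<Sum>j. F_coeff j * - (2 ^ j) * exp (- (2 ^ j) * x))) (at x)"
  proof (rule has_field_derivative_series'(2)[OF _ deriv uniform, of 0])
    show "summable (\<lambda>j. F_coeff j * exp (- (2 ^ j) * 0))" by (rule summable_F_term) simp
  qed (use assms in \<open>auto simp: interior_real_atLeast\<close>)
  moreover have "(\<Sum>j. F_coeff j * - (2 ^ j) * exp (- (2 ^ j) * x)) = 2 * F (2 * x) - F x"
  proof -
    have s: "summable (\<lambda>j. F_coeff j * - (2 ^ j) * exp (- (2 ^ j) * x))"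
    proof (rule summable_comparison_test'[OF summable_M, of 0])
      show "norm (F_coeff j * - (2 ^ j) * exp (- (2 ^ j) * x)) \<le> ?M j" for j
        unfolding real_norm_def using assms by (intro abs_mult_exp_le) auto
    qed
    note t = summable_F_term[of x] summable_F_term[of "2 * x"]
    have "(\<Sum>j. F_coeff j * - (2 ^ j) * exp (- (2 ^ j) * x)) + F x
       = (\<Sum>j. F_coeff j * (1 - 2 ^ j) * exp (- (2 ^ j) * x))"
      unfolding F_eq using assms by (subst suminf_add[OF s t(1)]) (auto simp: algebra_simps)
    also have "\<dots> = (\<Sum>j. F_coeff (Suc j) * (1 - 2 ^ Suc j) * exp (- (2 ^ Suc j) * x))"
    proof -
      have "summable (\<lambda>j. F_coeff j * (1 - 2 ^ j) * exp (- (2 ^ j) * x))"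
        using summable_add[OF s t(1)] assms by (auto simp: algebra_simps)
      from suminf_split_head[OF this] show ?thesis by simp
    qed
    also have "\<dots> = (\<Sum>j. 2 * (F_coeff j * exp (- (2 ^ j) * (2 * x))))"
      unfolding F_coeff_Suc by (simp add: mult_ac)
    also have "\<dots> = 2 * F (2 * x)"
      unfolding F_eq using assms by (intro suminf_mult t) auto
    finally show ?thesis by simp
  qed
  ultimately show ?thesis by (simp add: F_eq[abs_def])
qed

definition hypoexp_density :: "nat \<Rightarrow> real \<Rightarrow> real" where
  "hypoexp_density k x = (\<Sum>h\<le>k. hypoexp_coeff k h * exp (- (2 ^ h) * x))"

lemma hypoexp_density_0: "hypoexp_density (Suc k) 0 = 0"
  using hypoexp_moment_Suc_0[of k] by (simp add: hypoexp_density_def hypoexp_moment_def)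

text \<open>
  Solving \<open>g\<^sub>k\<^sub>+\<^sub>1 + g\<^sub>k\<^sub>+\<^sub>1' / v = g\<^sub>k\<close>, \<open>v = 2\<^sup>k\<^sup>+\<^sup>1\<close>, with integrating factor \<open>e\<^sup>v\<^sup>x\<close> from the initial
  value \<open>0\<close> preserves nonnegativity.
\<close>

lemma hypoexp_density_nonneg: "0 \<le> x \<Longrightarrow> 0 \<le> hypoexp_density k x"
proof (induction k arbitrary: x)
  case 0
  then show ?case by (simp add: hypoexp_density_def hypoexp_coeff_def)
next
  case (Suc k)
  let ?v = "2 ^ Suc k :: real"
  let ?H = "\<lambda>y. exp (?v * y) * hypoexp_density (Suc k) y"
  have deriv: "(?H has_real_derivative ?v * exp (?v * y) * hypoexp_density k y) (at y)" for y
  proof -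
    have "exp (?v * y) * (c * exp (- (2 ^ h) * y)) = c * exp ((?v - 2 ^ h) * y)" for c y h
      by (simp add: left_diff_distrib exp_diff exp_minus divide_inverse)
    then have H: "?H = (\<lambda>y. \<Sum>h\<le>Suc k. hypoexp_coeff (Suc k) h * exp ((?v - 2 ^ h) * y))"
      by (simp only: hypoexp_density_def sum_distrib_left)
    have "(?H has_real_derivative
        (\<Sum>h\<le>Suc k. hypoexp_coeff (Suc k) h * (?v - 2 ^ h) * exp ((?v - 2 ^ h) * y))) (at y)"
      unfolding H by (rule derivative_eq_intros refl)+ (simp add: mult_ac)
    also have "(\<Sum>h\<le>Suc k. hypoexp_coeff (Suc k) h * (?v - 2 ^ h) * exp ((?v - 2 ^ h) * y))
        = (\<Sum>h\<le>k. hypoexp_coeff (Suc k) h * (?v - 2 ^ h) * exp ((?v - 2 ^ h) * y))"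
      by (subst sum.atMost_Suc) simp
    also have "\<dots> = ?v * exp (?v * y) * hypoexp_density k y"
      unfolding hypoexp_density_def sum_distrib_left
    proof (intro sum.cong refl)
      fix h assume "h \<in> {..k}"
      then have "?v * (hypoexp_coeff (Suc k) h * (1 - 2 ^ h / ?v)) = ?v * hypoexp_coeff k h"
        by (simp only: hypoexp_coeff_Suc atMost_iff)
      then have "hypoexp_coeff (Suc k) h * (?v - 2 ^ h) = ?v * hypoexp_coeff k h"
        by (simp add: right_diff_distrib del: power_Suc) (simp add: mult_ac)
      moreover have "exp ((?v - 2 ^ h) * y) = exp (?v * y) * exp (- (2 ^ h) * y)"
        by (simp add: left_diff_distrib exp_diff exp_minus divide_inverse del: power_Suc)
      ultimately show "hypoexp_coeff (Suc k) h * (?v - 2 ^ h) * exp ((?v - 2 ^ h) * y)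
          = ?v * exp (?v * y) * (hypoexp_coeff k h * exp (- (2 ^ h) * y))" by simp
    qed
    finally show ?thesis .
  qed
  have "?H 0 \<le> ?H x"
    by (rule deriv_nonneg_imp_mono[OF deriv]) (use Suc in auto)
  then show ?case by (simp add: hypoexp_density_0 zero_le_mult_iff)
qed

text \<open>
  Nonnegativity of \<open>F\<close> and \<open>F 0 = 0\<close> are not visible in the alternating series of \<open>F\<close>; they are inherited from the \<open>g\<^sub>k\<close>
  through this limit.
\<close>

lemma hypoexp_density_limit:
  assumes "0 \<le> x"
  shows "(\<lambda>k. hypoexp_density k x) \<longlonglongrightarrow> F x"
proof -
  let ?a = "\<lambda>h k. if h \<le> k then hypoexp_coeff k h * exp (- (2 ^ h) * x) else 0"
  have lim: "(\<lambda>k. ?a h k) \<longlonglongrightarrow> F_coeff h * exp (- (2 ^ h) * x)" for h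
  proof -
    have "(\<lambda>k. Q (k - h)) \<longlonglongrightarrow> Q_inf"
      by (rule LIMSEQ_offset[of _ h]) (simp add: Q_limit)
    then have "(\<lambda>k. hypoexp_coeff k h * exp (- (2 ^ h) * x)) \<longlonglongrightarrow> F_coeff h * exp (- (2 ^ h) * x)"
      unfolding hypoexp_coeff_def F_coeff_def by (intro tendsto_intros) auto
    moreover have "eventually (\<lambda>k. ?a h k = hypoexp_coeff k h * exp (- (2 ^ h) * x)) sequentially"
      using eventually_ge_at_top[of h] by eventually_elim simp
    ultimately show ?thesis by (simp add: tendsto_cong)
  qed
  have bound: "norm (?a h k) \<le> 1 / Q_inf ^ 2 / 2 ^ (h choose 2)" for h k
    using abs_mult_exp_le[of "2 ^ h" x "hypoexp_coeff k h"] hypoexp_coeff_bound[of k h] assms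
    by auto
  have "(\<lambda>k. \<Sum>h. ?a h k) \<longlonglongrightarrow> (\<Sum>h. F_coeff h * exp (- (2 ^ h) * x))"
  proof (rule tannerys_theorem[of ?a "\<lambda>h. F_coeff h * exp (- (2 ^ h) * x)" sequentially
        "\<lambda>h. 1 / Q_inf ^ 2 / 2 ^ (h choose 2)", THEN conjunct2, THEN conjunct2, OF lim])
    show "\<forall>\<^sub>F (h, k) in at_top \<times>\<^sub>F sequentially. norm (?a h k) \<le> 1 / Q_inf ^ 2 / 2 ^ (h choose 2)"
      by (rule always_eventually) (use bound in \<open>auto simp del: real_norm_def\<close>)
  qed (auto intro: summable_choose_two simp del: divide_divide_eq_left)
  moreover have "(\<Sum>h. ?a h k) = hypoexp_density k x" for k
    unfolding hypoexp_density_def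
    by (subst suminf_finite[of "{..k}"]) (auto intro!: sum.cong)
  ultimately show ?thesis by (simp add: F_eq)
qed

lemma F_nonneg: "0 \<le> x \<Longrightarrow> 0 \<le> F x"
  using hypoexp_density_limit by (rule LIMSEQ_le_const) (auto intro: hypoexp_density_nonneg)

lemma F_0 [simp]: "F 0 = 0"
proof -
  have "(\<lambda>k. hypoexp_density (Suc k) 0) \<longlonglongrightarrow> F 0"
    by (rule LIMSEQ_Suc) (rule hypoexp_density_limit, simp)
  then show ?thesis by (simp add: hypoexp_density_0 LIMSEQ_const_iff)
qed

text \<open>
  \<open>F_ext m\<close> is the \<open>m\<close>-th derivative of the extension of \<open>F\<close> by zero to the whole line. The functional equation,
  differentiated \<open>m\<close> times, serves as the recursion, so no series has to be differentiated again.
\<close>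

primrec F_ext :: "nat \<Rightarrow> real \<Rightarrow> real" where
  "F_ext 0 x = (if x \<le> 0 then 0 else F x)"
| "F_ext (Suc m) x = 2 ^ Suc m * F_ext m (2 * x) - F_ext m x"

lemma F_ext_nonpos [simp]: "x \<le> 0 \<Longrightarrow> F_ext m x = 0"
  by (induction m arbitrary: x) auto

lemma F_ext_bounded: obtains B where "\<And>x. \<bar>F_ext m x\<bar> \<le> B"
proof -
  have "\<exists>B. \<forall>x. \<bar>F_ext m x\<bar> \<le> B"
  proof (induction m)
    case 0
    from F_bounded obtain B where B: "\<And>x. 0 \<le> x \<Longrightarrow> \<bar>F x\<bar> \<le> B" by metis
    from B[of 0] have "0 \<le> B" by simp
    with B show ?case by (intro exI[of _ B]) auto
  next
    case (Suc m)
    then obtain B where B: "\<And>x. \<bar>F_ext m x\<bar> \<le> B" by auto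
    have "\<bar>F_ext (Suc m) x\<bar> \<le> 2 ^ Suc m * B + B" for x
    proof -
      have "\<bar>2 ^ Suc m * F_ext m (2 * x)\<bar> \<le> 2 ^ Suc m * B"
        unfolding abs_mult using B[of "2 * x"] by (intro mult_mono) auto
      then show ?thesis using B[of x] by (simp del: power_Suc)
    qed
    then show ?case by blast
  qed
  then show ?thesis using that by blast
qed

lemma continuous_F_ext_0: "continuous_on UNIV (F_ext 0)"
proof -
  have "continuous_on ({..0} \<union> {0..}) (\<lambda>x. if x \<le> 0 then 0 else F x)"
    by (rule continuous_on_If) (auto intro: continuous_on_F)
  moreover have "{..0} \<union> {0..} = (UNIV :: real set)" by auto
  ultimately show ?thesis by simp
qed

text \<open>
  At the origin the mean value theorem reduces differentiability to the right-hand side of the functional equation, which is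
  continuous and vanishes at \<open>0\<close>.
\<close>

lemma F_ext_0_has_derivative: "(F_ext 0 has_real_derivative F_ext 1 x) (at x)"
proof -
  consider "x < 0" | "x = 0" | "0 < x" by linarith
  then show ?thesis
  proof cases
    case 1
    have "((\<lambda>_. 0) has_real_derivative F_ext 1 x) (at x)"
      using 1 by (auto intro!: derivative_eq_intros)
    then show ?thesis
      by (rule has_field_derivative_transform_within_open[of _ _ _ "{..<0}"]) (use 1 in auto)
  next
    case 3
    have "(F has_real_derivative F_ext 1 x) (at x)"
      using F_has_derivative[OF 3] 3 by simp
    then show ?thesis
      by (rule has_field_derivative_transform_within_open[of _ _ _ "{0<..}"]) (use 3 in auto)
  next
    case 2
    have pos: "(F_ext 0 has_real_derivative F_ext 1 y) (at y)" if "0 < y" for y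
    proof -
      have "(F has_real_derivative F_ext 1 y) (at y)"
        using F_has_derivative[OF that] that by simp
      then show ?thesis
        by (rule has_field_derivative_transform_within_open[of _ _ _ "{0<..}"]) (use that in auto)
    qed
    have "continuous_on UNIV (\<lambda>x. 2 ^ Suc 0 * F_ext 0 (2 * x) - F_ext 0 x)"
      by (intro continuous_on_diff continuous_on_mult_left continuous_F_ext_0
          continuous_on_compose2[OF continuous_F_ext_0] continuous_on_id) auto
    then have "continuous_on UNIV (F_ext 1)" 
      by (simp only: One_nat_def F_ext.simps(2)[abs_def])
    then have "isCont (F_ext 1) 0"
      using continuous_on_eq_continuous_at[OF open_UNIV] by blast
    then have lim: "(F_ext 1 \<longlongrightarrow> 0) (at 0)" by (simp add: isCont_def)
    have "((\<lambda>h. F_ext 0 h / h) \<longlongrightarrow> 0) (at 0)"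
      unfolding LIM_def
    proof (intro allI impI)
      fix e :: real assume "0 < e"
      with lim obtain d where d: "0 < d" "\<And>y. y \<noteq> 0 \<Longrightarrow> \<bar>y\<bar> < d \<Longrightarrow> \<bar>F_ext 1 y\<bar> < e"
        unfolding LIM_def dist_real_def by force
      have "\<bar>F_ext 0 h / h\<bar> < e" if h: "h \<noteq> 0" "\<bar>h\<bar> < d" for h
      proof (cases "h < 0")
        case True
        then show ?thesis using \<open>0 < e\<close> by simp
      next
        case False
        with h have "0 < h" by simp
        have "continuous_on {0..h} (F_ext 0)" using continuous_F_ext_0 continuous_on_subset by blast
        then obtain l z where z: "0 < z" "z < h" "DERIV (F_ext 0) z :> l"
            "F_ext 0 h - F_ext 0 0 = (h - 0) * l"
          using MVT[OF \<open>0 < h\<close>, of "F_ext 0"] pos real_differentiable_def by blast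
        with pos[of z] have "l = F_ext 1 z" using DERIV_unique by blast
        with z h \<open>0 < h\<close> have "F_ext 0 h / h = F_ext 1 z" by (simp del: F_ext.simps)
        then show ?thesis using d(2)[of z] z h by simp
      qed
      then show "\<exists>d>0. \<forall>h. h \<noteq> 0 \<and> dist h 0 < d \<longrightarrow> dist (F_ext 0 h / h) 0 < e"
        using d(1) by (auto simp: dist_real_def simp del: F_ext.simps)
    qed
    then show ?thesis using 2 by (simp add: has_field_derivative_iff)
  qed
qed

lemma F_ext_has_derivative: "(F_ext m has_real_derivative F_ext (Suc m) x) (at x)"
proof (induction m arbitrary: x)
  case 0
  then show ?case using F_ext_0_has_derivative by (simp only: One_nat_def)
next
  case (Suc m)
  have "((\<lambda>x. 2 ^ Suc m * F_ext m (2 * x) - F_ext m x) has_real_derivative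
      2 ^ Suc m * (F_ext (Suc m) (2 * x) * 2) - F_ext (Suc m) x) (at x)"
    by (intro DERIV_diff DERIV_cmult DERIV_chain2[OF Suc.IH] Suc.IH)
       (auto intro!: derivative_eq_intros)
  moreover have "F_ext (Suc m) = (\<lambda>x. 2 ^ Suc m * F_ext m (2 * x) - F_ext m x)"
    by (rule ext) simp
  moreover have "F_ext (Suc (Suc m)) x = 2 ^ Suc m * (F_ext (Suc m) (2 * x) * 2) - F_ext (Suc m) x"
    unfolding F_ext.simps(2)[of "Suc m"] by simp
  ultimately show ?case by metis
qed

lemma continuous_on_F_ext [continuous_intros]:
  "continuous_on A f \<Longrightarrow> continuous_on A (\<lambda>x. F_ext m (f x))"
  by (rule continuous_on_compose2[of UNIV]) (auto intro: DERIV_continuous_on F_ext_has_derivative)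

text \<open>
  The function \<open>e\<^sup>x F\<^sup>(\<^sup>m\<^sup>) x\<close> has derivative \<open>2\<^sup>m\<^sup>+\<^sup>1 e\<^sup>x F\<^sup>(\<^sup>m\<^sup>) (2 x)\<close>, hence increases as long as \<open>F\<^sup>(\<^sup>m\<^sup>)\<close>
  is nonnegative. Comparing its values at \<open>x\<close> and \<open>2 x\<close> bounds \<open>F\<^sup>(\<^sup>m\<^sup>) x\<close> by \<open>e\<^sup>x F\<^sup>(\<^sup>m\<^sup>) (2 x)\<close>, which makes
  \<open>F\<^sup>(\<^sup>m\<^sup>+\<^sup>1\<^sup>) x = 2\<^sup>m\<^sup>+\<^sup>1 F\<^sup>(\<^sup>m\<^sup>) (2 x) - F\<^sup>(\<^sup>m\<^sup>) x\<close> nonnegative.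
\<close>

lemma F_ext_nonneg_near_0: "\<exists>\<delta>>0. \<forall>x\<le>\<delta>. 0 \<le> F_ext m x"
proof (induction m)
  case 0
  show ?case by (intro exI[of _ 1]) (auto simp: F_nonneg)
next
  case (Suc m)
  then obtain \<delta> where \<delta>: "0 < \<delta>" "\<And>x. x \<le> \<delta> \<Longrightarrow> 0 \<le> F_ext m x" by auto
  let ?H = "\<lambda>x. exp x * F_ext m x"
  have deriv: "(?H has_real_derivative exp x * (2 ^ Suc m * F_ext m (2 * x))) (at x)" for x
    by (rule derivative_eq_intros F_ext_has_derivative refl)+ (simp add: algebra_simps)
  \<comment> \<open>On \<open>[x, 2 x]\<close> the derivative involves arguments up to \<open>4 x\<close>, and \<open>e\<^sup>x \<le> 2 \<le> 2\<^sup>m\<^sup>+\<^sup>1\<close> is needed.\<close>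
  have "0 \<le> F_ext (Suc m) x" if x: "0 < x" "x \<le> min (\<delta> / 4) (ln 2)" for x
  proof -
    have "?H x \<le> ?H (2 * x)"
      by (rule deriv_nonneg_imp_mono[OF deriv]) (use x \<delta> in auto)
    then have "F_ext m x \<le> exp x * F_ext m (2 * x)"
      unfolding mult_2 exp_add by simp
    also have "\<dots> \<le> 2 * F_ext m (2 * x)"
      using x \<delta> by (intro mult_right_mono) (auto simp: ln_ge_iff)
    also have "\<dots> \<le> 2 ^ Suc m * F_ext m (2 * x)"
      using x \<delta> by (intro mult_right_mono) auto
    finally show ?thesis by simp
  qed
  then have "0 \<le> F_ext (Suc m) x" if "x \<le> min (\<delta> / 4) (ln 2)" for x
    using that by (cases "x \<le> 0") (auto simp del: F_ext.simps)
  then show ?case using \<delta>(1) by (intro exI[of _ "min (\<delta> / 4) (ln 2)"]) auto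
qed

lemma F_ext_mono_near_0: "\<exists>\<delta>>0. \<forall>y\<le>\<delta>. \<forall>x\<le>y. 0 \<le> F_ext m x \<and> F_ext m x \<le> F_ext m y"
proof -
  from F_ext_nonneg_near_0[of m] obtain \<delta> where \<delta>: "0 < \<delta>" "\<And>x. x \<le> \<delta> \<Longrightarrow> 0 \<le> F_ext m x" by auto
  from F_ext_nonneg_near_0[of "Suc m"] obtain \<epsilon>
    where \<epsilon>: "0 < \<epsilon>" "\<And>x. x \<le> \<epsilon> \<Longrightarrow> 0 \<le> F_ext (Suc m) x" by auto
  have "F_ext m x \<le> F_ext m y" if "x \<le> y" "y \<le> \<epsilon>" for x y
    by (rule deriv_nonneg_imp_mono[OF F_ext_has_derivative]) (use that \<epsilon> in \<open>auto simp del: F_ext.simps\<close>)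
  with \<delta> \<epsilon> show ?thesis by (intro exI[of _ "min \<delta> \<epsilon>"]) auto
qed

lemma deriv_iterate_eq:
  assumes "open S" "\<And>m x. x \<in> S \<Longrightarrow> (h m has_field_derivative h (Suc m) x) (at x)"
    and "\<And>x. x \<in> S \<Longrightarrow> f x = h 0 x" "x \<in> S"
  shows "(deriv ^^ m) f x = h m x"
  using assms(4)
proof (induction m arbitrary: x)
  case 0
  then show ?case using assms(3) by simp
next
  case (Suc m)
  have "((deriv ^^ m) f has_field_derivative h (Suc m) x) (at x)"
    by (rule has_field_derivative_transform_within_open[OF assms(2)[OF Suc.prems] assms(1) Suc.prems])
       (simp add: Suc.IH)
  then show ?case by (simp add: DERIV_imp_deriv)
qed

lemma deriv_iterate_F: "0 < x \<Longrightarrow> (deriv ^^ m) F x = F_ext m x"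
  by (rule deriv_iterate_eq[of "{0<..}"]) (auto intro: F_ext_has_derivative simp del: F_ext.simps(2))

section \<open>Transferring differential factors across the convolution\<close>

lemma four_power: "(4::real) ^ h = (2 ^ h) ^ 2"
  by (simp add: power2_eq_square flip: power_mult_distrib)

text \<open>
  Expanding \<open>(2\<^sup>h + 2\<^sup>l)\<^sup>k\<close> produces products of derivatives of \<open>g\<^sub>j''\<close> at \<open>0\<close> of orders \<open>a\<close> and \<open>k - a\<close>. If
  \<open>k < 2 (j - 2)\<close>, one of the two orders is below \<open>j - 2\<close> and that factor is zero. In other words,
  \<open>(g\<^sub>j'')\<^sup>2\<close> vanishes to order \<open>2 j - 4\<close> at the origin.
\<close>

lemma hypoexp_moment_convolution:
  fixes q :: "real poly"
  assumes "degree q < 2 * (j - 2)"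
  shows "(\<Sum>h\<le>j. \<Sum>l\<le>j. 4 ^ h * hypoexp_coeff j h * (4 ^ l * hypoexp_coeff j l)
           * poly q (2 ^ h + 2 ^ l)) = 0"
proof -
  define c where "c h = 4 ^ h * hypoexp_coeff j h" for h
  have moment: "(\<Sum>h\<le>j. c h * (2 ^ h) ^ a) = hypoexp_moment j (a + 2)" for a
  proof -
    show ?thesis by (simp add: c_def four_power hypoexp_moment_def power_add power2_eq_square mult_ac)
  qed
  have power_zero: "(\<Sum>h\<le>j. \<Sum>l\<le>j. c h * c l * (2 ^ h + 2 ^ l) ^ k) = 0" if "k < 2 * (j - 2)" for k
  proof -
    have "(\<Sum>h\<le>j. \<Sum>l\<le>j. c h * c l * (2 ^ h + 2 ^ l) ^ k)
       = (\<Sum>h\<le>j. \<Sum>l\<le>j. \<Sum>a\<le>k. real (k choose a) * ((c h * (2 ^ h) ^ a) * (c l * (2 ^ l) ^ (k - a))))"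
      by (simp add: binomial_ring sum_distrib_left mult_ac)
    also have "\<dots> = (\<Sum>h\<le>j. \<Sum>a\<le>k. \<Sum>l\<le>j. real (k choose a) * ((c h * (2 ^ h) ^ a) * (c l * (2 ^ l) ^ (k - a))))"
      by (intro sum.cong refl sum.swap)
    also have "\<dots> = (\<Sum>a\<le>k. \<Sum>h\<le>j. \<Sum>l\<le>j. real (k choose a) * ((c h * (2 ^ h) ^ a) * (c l * (2 ^ l) ^ (k - a))))"
      by (rule sum.swap)
    also have "\<dots> = (\<Sum>a\<le>k. real (k choose a) *
        (hypoexp_moment j (a + 2) * hypoexp_moment j (k - a + 2)))"
      unfolding moment[symmetric] unfolding sum_product by (simp only: sum_distrib_left)
    also have "\<dots> = 0"
    proof (intro sum.neutral ballI)
      fix a assume "a \<in> {..k}"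
      with that have "a + 2 < j \<or> k - a + 2 < j" by auto
      then show "real (k choose a) * (hypoexp_moment j (a + 2) * hypoexp_moment j (k - a + 2)) = 0"
        using hypoexp_moment_eq_0 by auto
    qed
    finally show ?thesis .
  qed
  have "(\<Sum>h\<le>j. \<Sum>l\<le>j. c h * c l * poly q (2 ^ h + 2 ^ l))
     = (\<Sum>h\<le>j. \<Sum>l\<le>j. \<Sum>k\<le>degree q. coeff q k * (c h * c l * (2 ^ h + 2 ^ l) ^ k))"
    by (simp add: poly_altdef sum_distrib_left mult_ac)
  also have "\<dots> = (\<Sum>h\<le>j. \<Sum>k\<le>degree q. \<Sum>l\<le>j. coeff q k * (c h * c l * (2 ^ h + 2 ^ l) ^ k))"
    by (intro sum.cong refl sum.swap)
  also have "\<dots> = (\<Sum>k\<le>degree q. \<Sum>h\<le>j. \<Sum>l\<le>j. coeff q k * (c h * c l * (2 ^ h + 2 ^ l) ^ k))"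
    by (rule sum.swap)
  also have "\<dots> = (\<Sum>k\<le>degree q. coeff q k * (\<Sum>h\<le>j. \<Sum>l\<le>j. c h * c l * (2 ^ h + 2 ^ l) ^ k))"
    by (simp add: sum_distrib_left)
  also have "\<dots> = 0" using assms power_zero by (intro sum.neutral) auto
  finally show ?thesis by (simp add: c_def)
qed

text \<open>
  The polynomial in \<open>v\<close> by which \<open>\<Prod>\<^sub>k\<^sub>\<in>\<^sub>A (1 + D / 2\<^sup>k)\<close> multiplies \<open>e\<^sup>-\<^sup>v\<^sup>t\<close>. On \<open>t e\<^sup>-\<^sup>v\<^sup>t\<close>, which is minus the
  \<open>v\<close>-derivative of \<open>e\<^sup>-\<^sup>v\<^sup>t\<close>, the operator yields \<open>(p v \<cdot> t - p' v) e\<^sup>-\<^sup>v\<^sup>t\<close>.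
\<close>

definition factor_poly :: "nat set \<Rightarrow> real poly" where
  "factor_poly A = (\<Prod>k\<in>A. [:1, - 1 / 2 ^ k:])"

lemma poly_factor_poly_insert:
  assumes "finite A" "k \<notin> A"
  shows "poly (factor_poly (insert k A)) v = (1 - v / 2 ^ k) * poly (factor_poly A) v"
    and "poly (pderiv (factor_poly (insert k A))) v =
      (1 - v / 2 ^ k) * poly (pderiv (factor_poly A)) v - poly (factor_poly A) v / 2 ^ k"
proof -
  have ins: "factor_poly (insert k A) = [:1, - 1 / 2 ^ k:] * factor_poly A"
    using assms by (simp add: factor_poly_def)
  show "poly (factor_poly (insert k A)) v = (1 - v / 2 ^ k) * poly (factor_poly A) v"
    unfolding ins poly_mult by simp
  have "pderiv [:1, - 1 / 2 ^ k:] = [:- 1 / 2 ^ k :: real:]" by (simp add: pderiv_pCons)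
  then show "poly (pderiv (factor_poly (insert k A))) v =
      (1 - v / 2 ^ k) * poly (pderiv (factor_poly A)) v - poly (factor_poly A) v / 2 ^ k"
    unfolding ins pderiv_mult poly_add poly_mult by simp
qed

lemma degree_factor_poly: "finite A \<Longrightarrow> degree (factor_poly A) \<le> card A"
  unfolding factor_poly_def
  by (rule order.trans[OF degree_prod_sum_le]) (auto intro: sum_bounded_above[where K = 1, simplified])

text \<open>
  \<open>source j i\<close> is \<open>\<Prod>\<^sub>i\<^sub>\<le>\<^sub>k\<^sub><\<^sub>j (1 + D / 2\<^sup>k)\<close> applied to \<open>t (g\<^sub>j'' t)\<^sup>2\<close>, expanded into exponentials. The factors
  \<open>4\<^sup>h\<close> and \<open>4\<^sup>l\<close> come from the two derivatives of \<open>g\<^sub>j\<close>.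
\<close>

definition source :: "nat \<Rightarrow> nat \<Rightarrow> real \<Rightarrow> real" where
  "source j i t = (\<Sum>h\<le>j. \<Sum>l\<le>j. 4 ^ h * hypoexp_coeff j h * (4 ^ l * hypoexp_coeff j l) *
     ((poly (factor_poly {i..<j}) (2 ^ h + 2 ^ l) * t
        - poly (pderiv (factor_poly {i..<j})) (2 ^ h + 2 ^ l)) * exp (- (2 ^ h + 2 ^ l) * t)))"

text \<open>
  A rearrangement of \<open>source j i = (1 + D / 2\<^sup>i) (source j (i + 1))\<close>.
\<close>

lemma source_has_derivative:
  assumes "i < j"
  shows "(source j (Suc i) has_real_derivative 2 ^ i * (source j i t - source j (Suc i) t)) (at t)"
proof -
  let ?p = "factor_poly {Suc i..<j}"
  have ins: "{i..<j} = insert i {Suc i..<j}" using assms by auto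
  have summand: "((\<lambda>t. c * ((poly ?p v * t - poly (pderiv ?p) v) * exp (- v * t)))
    has_real_derivative 2 ^ i *
      (c * ((poly (factor_poly {i..<j}) v * t - poly (pderiv (factor_poly {i..<j})) v) * exp (- v * t))
        - c * ((poly ?p v * t - poly (pderiv ?p) v) * exp (- v * t)))) (at t)" for c v
    unfolding ins by (subst poly_factor_poly_insert; simp?)+
      (auto intro!: derivative_eq_intros simp: field_simps)
  show ?thesis
    unfolding source_def sum_distrib_left right_diff_distrib sum_subtractf[symmetric]
    by (intro DERIV_sum) (use summand in \<open>simp only: right_diff_distrib\<close>)
qed

lemma continuous_on_source [continuous_intros]:
  "continuous_on A f \<Longrightarrow> continuous_on A (\<lambda>x. source j i (f x))"
  unfolding source_def by (intro continuous_intros)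

text \<open>
  At most \<open>j - 1\<close> derivatives have been applied to a function vanishing to order \<open>2 j - 3\<close>, and \<open>2 j - 3 > j - 1\<close> for
  \<open>j \<ge> 3\<close>. The exception \<open>j = 2\<close> contributes \<open>(g\<^sub>2'' 0)\<^sup>2 / 2 = 32\<close>.
\<close>

lemma source_0:
  assumes "i < j"
  shows "source j (Suc i) 0 = (if j = 2 \<and> i = 0 then 32 else 0)"
proof -
  let ?p = "factor_poly {Suc i..<j}"
  have src: "source j (Suc i) 0 = - (\<Sum>h\<le>j. \<Sum>l\<le>j. 4 ^ h * hypoexp_coeff j h *
      (4 ^ l * hypoexp_coeff j l) * poly (pderiv ?p) (2 ^ h + 2 ^ l))"
    by (simp add: source_def sum_negf)
  consider "j = 2" "i = 0" | "Suc i = j" | "3 \<le> j" "Suc i < j" using assms by linarith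
  then show ?thesis
  proof cases
    case 1
    have "{Suc 0..<2} = {1::nat}" by auto
    then have "pderiv ?p = [:- 1 / 2:]" using 1 by (simp add: factor_poly_def pderiv_pCons)
    moreover have "(\<Sum>h\<le>2. 4 ^ h * hypoexp_coeff 2 h) = 8"
    proof -
      show ?thesis using hypoexp_moment_2_2 by (simp add: hypoexp_moment_def four_power mult.commute)
    qed
    then have "(\<Sum>h\<le>2. \<Sum>l\<le>2. 4 ^ h * hypoexp_coeff 2 h * (4 ^ l * hypoexp_coeff 2 l)) = 64"
      by (simp flip: sum_product)
    ultimately show ?thesis using 1 src by (simp add: sum_negf flip: sum_divide_distrib)
  next
    case 2
    then show ?thesis using src by (auto simp: factor_poly_def pderiv_1)
  next
    case 3
    have "degree (pderiv ?p) < 2 * (j - 2)"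
      using degree_factor_poly[of "{Suc i..<j}"] 3 by (simp add: degree_pderiv)
    from hypoexp_moment_convolution[OF this] show ?thesis using 3 src by simp
  qed
qed

text \<open>
  The density \<open>K\<^sub>i\<close> of \<open>\<Sum>\<^sub>k\<^sub>\<ge>\<^sub>i E\<^sub>k / 2\<^sup>k\<close>, which is a rescaled copy of \<open>F\<close>.
\<close>

definition tail_density :: "nat \<Rightarrow> real \<Rightarrow> real" where
  "tail_density i x = 2 ^ i * F_ext 0 (2 ^ i * x)"

lemma tail_density_0: "tail_density i 0 = 0"
  by (simp add: tail_density_def)

lemma tail_density_has_derivative:
  "(tail_density i has_real_derivative 2 ^ i * (tail_density (Suc i) x - tail_density i x)) (at x)"
proof -
  have "(tail_density i has_real_derivative 2 ^ i * (F_ext 1 (2 ^ i * x) * 2 ^ i)) (at x)"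
    unfolding tail_density_def
    by (intro DERIV_cmult DERIV_chain2[where f = "F_ext 0"] F_ext_0_has_derivative)
       (auto intro!: derivative_eq_intros)
  moreover have "F_ext 1 (2 ^ i * x) * 2 ^ i = tail_density (Suc i) x - tail_density i x"
    unfolding tail_density_def One_nat_def F_ext.simps(2) by (simp add: algebra_simps del: F_ext.simps(1))
  ultimately show ?thesis by simp
qed

lemma continuous_on_tail_density [continuous_intros]:
  "continuous_on A f \<Longrightarrow> continuous_on A (\<lambda>x. tail_density i (f x))"
  unfolding tail_density_def by (intro continuous_intros)

text \<open>
  Integration by parts: up to the factor \<open>2\<^sup>i\<close>, the two integrands differ by the derivative of
  \<open>K\<^sub>i (x - t) \<cdot> source j (i + 1) t\<close>, which is zero at \<open>t = x\<close> since \<open>F\<close> vanishes at the origin.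
\<close>

lemma convolution_shift_step:
  assumes "i < j" "0 \<le> x"
  shows "integral {0..x} (\<lambda>t. tail_density (Suc i) (x - t) * source j (Suc i) t)
    = integral {0..x} (\<lambda>t. tail_density i (x - t) * source j i t)
      + source j (Suc i) 0 / 2 ^ i * tail_density i x"
proof -
  let ?K = tail_density
  have "((\<lambda>t. ?K i (x - t) * source j (Suc i) t) has_real_derivative
      2 ^ i * (?K i (x - t) * source j i t - ?K (Suc i) (x - t) * source j (Suc i) t)) (at t)" for t
  proof -
    have "((\<lambda>t. ?K i (x - t)) has_real_derivative
        2 ^ i * (?K (Suc i) (x - t) - ?K i (x - t)) * (- 1)) (at t)"
      by (rule DERIV_chain2[OF tail_density_has_derivative]) (auto intro!: derivative_eq_intros)
    from DERIV_mult[OF this source_has_derivative[OF assms(1)]]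
    show ?thesis by (simp add: algebra_simps)
  qed
  then have "((\<lambda>t. 2 ^ i * (?K i (x - t) * source j i t - ?K (Suc i) (x - t) * source j (Suc i) t))
      has_integral ?K i (x - x) * source j (Suc i) x - ?K i (x - 0) * source j (Suc i) 0) {0..x}"
    using assms(2) by (intro fundamental_theorem_of_calculus)
      (auto intro: has_field_derivative_at_within simp flip: has_real_derivative_iff_has_vector_derivative)
  then have "integral {0..x} (\<lambda>t. 2 ^ i * (?K i (x - t) * source j i t - ?K (Suc i) (x - t) * source j (Suc i) t))
     = - (?K i x * source j (Suc i) 0)"
    by (simp only: integral_unique diff_self diff_zero tail_density_0 mult_zero_left diff_0)
  moreover have "integral {0..x} (\<lambda>t. 2 ^ i * (?K i (x - t) * source j i t - ?K (Suc i) (x - t) * source j (Suc i) t))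
     = 2 ^ i * (integral {0..x} (\<lambda>t. ?K i (x - t) * source j i t)
        - integral {0..x} (\<lambda>t. ?K (Suc i) (x - t) * source j (Suc i) t))"
    by (subst integral_mult_right, subst integral_diff)
       (auto intro!: integrable_continuous_real continuous_intros)
  ultimately show ?thesis by (simp add: field_simps)
qed

lemma convolution_shift:
  assumes "0 \<le> x"
  shows "integral {0..x} (\<lambda>t. tail_density j (x - t) * source j j t)
    = integral {0..x} (\<lambda>t. F_ext 0 (x - t) * source j 0 t) + (if j = 2 then 32 * F_ext 0 x else 0)"
proof -
  have "i \<le> j \<Longrightarrow> integral {0..x} (\<lambda>t. tail_density j (x - t) * source j j t)
    = integral {0..x} (\<lambda>t. tail_density i (x - t) * source j i t)
      + (if j = 2 \<and> i = 0 then 32 * F_ext 0 x else 0)" for i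
  proof (induction i rule: inc_induct)
    case base
    then show ?case by simp
  next
    case (step i)
    then show ?case
      using convolution_shift_step[OF \<open>i < j\<close> assms] source_0[OF \<open>i < j\<close>]
      by (auto simp: tail_density_def simp del: F_ext.simps)
  qed
  from this[of 0] show ?thesis by (simp add: tail_density_def del: F_ext.simps)
qed

section \<open>Size of the correction\<close>

text \<open>
  The derivative of the product loses one factor \<open>1 - v / 2\<^sup>k\<close> and gains \<open>1 / 2\<^sup>k\<close>; the second hypothesis on \<open>b\<close>
  makes each such exchange cost at most \<open>1 / w\<close>.
\<close>

lemma factor_poly_bounds:
  assumes "finite A" "0 < w"
    and "\<And>k. k \<in> A \<Longrightarrow> \<bar>1 - v / 2 ^ k\<bar> \<le> b k" "\<And>k. k \<in> A \<Longrightarrow> 1 / 2 ^ k \<le> b k / w"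
  shows "\<bar>poly (factor_poly A) v\<bar> \<le> prod b A \<and>
    \<bar>poly (pderiv (factor_poly A)) v\<bar> \<le> card A / w * prod b A"
  using assms(1,3,4)
proof (induction A rule: finite_induct)
  case empty
  then show ?case by (simp add: factor_poly_def pderiv_1)
next
  case (insert k A)
  then have IH: "\<bar>poly (factor_poly A) v\<bar> \<le> prod b A"
      "\<bar>poly (pderiv (factor_poly A)) v\<bar> \<le> card A / w * prod b A" by auto
  have k: "\<bar>1 - v / 2 ^ k\<bar> \<le> b k" "1 / 2 ^ k \<le> b k / w" using insert.prems by auto
  have b0: "0 \<le> b k" using k(1) by linarith
  have "\<bar>(1 - v / 2 ^ k) * poly (factor_poly A) v\<bar> \<le> b k * prod b A"
    unfolding abs_mult using k(1) IH(1) b0 by (intro mult_mono) auto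
  moreover have "\<bar>(1 - v / 2 ^ k) * poly (pderiv (factor_poly A)) v\<bar> \<le> b k * (card A / w * prod b A)"
    unfolding abs_mult using k(1) IH(2) b0 by (intro mult_mono) auto
  moreover have "\<bar>poly (factor_poly A) v / 2 ^ k\<bar> \<le> b k / w * prod b A"
  proof -
    have "\<bar>poly (factor_poly A) v\<bar> * (1 / 2 ^ k) \<le> prod b A * (b k / w)"
      using k(2) IH(1) b0 assms(2) by (intro mult_mono) auto
    then show ?thesis by (simp add: abs_mult mult.commute)
  qed
  moreover have "real (card (insert k A)) / w * prod b (insert k A)
      = b k * (card A / w * prod b A) + b k / w * prod b A"
    using insert.hyps assms(2) by (simp add: field_simps)
  moreover have "prod b (insert k A) = b k * prod b A" using insert.hyps by simp
  ultimately show ?case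
    unfolding poly_factor_poly_insert[OF insert.hyps] by linarith
qed

lemma prod_power_diff: "M \<le> j \<Longrightarrow> (\<Prod>k<j. 2 ^ (M - k)) = (2::real) ^ (Suc M choose 2)"
proof (induction M)
  case 0
  then show ?case by (simp add: binomial_eq_0)
next
  case (Suc M)
  have "(\<Prod>k<j. 2 ^ (Suc M - k)) = (\<Prod>k<j. 2 ^ (M - k) * (if k \<le> M then 2 else 1 :: real))"
    by (intro prod.cong refl) (auto simp: Suc_diff_le)
  also have "\<dots> = 2 ^ (Suc M choose 2) * (\<Prod>k<j. if k \<le> M then 2 else 1)"
    using Suc by (simp add: prod.distrib)
  also have "(\<Prod>k<j. if k \<le> M then 2 else 1 :: real) = 2 ^ Suc M"
  proof -
    have "{..<j} \<inter> {k. k \<le> M} = {..M}" using Suc.prems by auto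
    then show ?thesis by (simp add: prod.If_cases)
  qed
  finally show ?case by (simp add: choose_two_Suc power_add)
qed

text \<open>
  The exponent \<open>3 l - l (l - 1) / 2\<close> is largest at \<open>l = 3\<close> and \<open>l = 4\<close>, where it equals \<open>6\<close>.
\<close>

lemma eight_power_le: "8 ^ l \<le> (64::real) * 2 ^ (l choose 2)"
proof -
  have "8 ^ (3 + k) \<le> (64::real) * 2 ^ (3 + k choose 2)" for k
  proof (induction k)
    case 0
    then show ?case by (simp add: numeral_3_eq_3 numeral_2_eq_2)
  next
    case (Suc k)
    have "(8::real) = 2 ^ 3" by simp
    also have "\<dots> \<le> 2 ^ (3 + k)" by (rule power_increasing) auto
    finally have "8 * 8 ^ (3 + k) \<le> 2 ^ (3 + k) * (64 * (2::real) ^ (3 + k choose 2))"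
      using Suc by (intro mult_mono) auto
    then show ?case
      unfolding add_Suc_right choose_two_Suc power_add power_Suc by (simp add: mult_ac)
  qed
  from this[of "l - 3"] have "3 \<le> l \<Longrightarrow> ?thesis" by simp
  moreover have "l < 3 \<Longrightarrow> ?thesis"
    by (auto simp: less_Suc_eq numeral_3_eq_3 numeral_2_eq_2)
  ultimately show ?thesis by linarith
qed

text \<open>
  The factors \<open>1 - v / 2\<^sup>k\<close> with \<open>k < h\<close> multiply to about \<open>2\<close> to the power \<open>h (h + 1) / 2\<close>, which the coefficient of
  index \<open>h\<close> reduces to \<open>8\<^sup>h\<close>; the \<open>L\<^sup>1\<close> norm of \<open>t e\<^sup>-\<^sup>v\<^sup>t\<close> supplies another \<open>4\<^sup>-\<^sup>h\<close>. What remains is \<open>2\<^sup>h\<close>, small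
  against the weight \<open>4\<^sup>j\<close> that divides \<open>source j 0\<close>. For this the crude bound \<open>v \<le> 2 \<cdot> 2\<^sup>h\<close> would lose a further
  \<open>2\<^sup>h\<close>; it is used only for \<open>k < l\<close>, where the coefficient of index \<open>l\<close> absorbs the loss.
\<close>

lemma source_coeff_bounds:
  assumes "l \<le> h" "h \<le> j"
  defines "v \<equiv> 2 ^ h + 2 ^ l" and "p \<equiv> factor_poly {0..<j}"
    and "c \<equiv> 4 ^ h * hypoexp_coeff j h * (4 ^ l * hypoexp_coeff j l)"
  shows "\<bar>c\<bar> * (\<bar>poly p v\<bar> / v\<^sup>2 + \<bar>poly (pderiv p) v\<bar> / v) \<le> 64 / Q_inf ^ 4 * (real j + 1) * 2 ^ j"
proof -
  define b :: "nat \<Rightarrow> real" where "b k = (if k < l then 2 else 1) * 2 ^ (h - k)" for k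
  have b1: "\<bar>1 - v / 2 ^ k\<bar> \<le> b k" for k
  proof (cases "h \<le> k")
    case True
    have "2 ^ h \<le> (2::real) ^ k" "2 ^ l \<le> (2::real) ^ k"
      using True assms(1) by (auto intro: power_increasing)
    then have "v \<le> 2 * 2 ^ k" unfolding v_def by linarith
    then have "v / 2 ^ k \<le> 2" by (simp add: field_simps)
    moreover have "0 \<le> v / 2 ^ k" by (simp add: v_def)
    ultimately show ?thesis using True assms(1) by (simp add: b_def abs_le_iff)
  next
    case False
    then have p: "(2::real) ^ h / 2 ^ k = 2 ^ (h - k)" by (simp add: power_diff)
    have one: "(1::real) \<le> 2 ^ (h - k)" by simp
    show ?thesis
    proof (cases "k < l")
      case True
      have "2 ^ l / 2 ^ k \<le> (2::real) ^ h / 2 ^ k"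
        using assms(1) by (intro divide_right_mono power_increasing) auto
      then have "v / 2 ^ k \<le> 2 * 2 ^ (h - k)" unfolding v_def add_divide_distrib p by simp
      moreover have "0 \<le> v / 2 ^ k" by (simp add: v_def)
      moreover have "b k = 2 * 2 ^ (h - k)" using True by (simp add: b_def)
      ultimately show ?thesis unfolding abs_le_iff using one by linarith
    next
      case False
      then have "2 ^ l / 2 ^ k \<le> (1::real)" by (simp add: power_increasing)
      then have "v / 2 ^ k \<le> 2 ^ (h - k) + 1" unfolding v_def add_divide_distrib p by simp
      moreover have "0 \<le> v / 2 ^ k" by (simp add: v_def)
      moreover have "b k = 2 ^ (h - k)" using False by (simp add: b_def)
      ultimately show ?thesis unfolding abs_le_iff using one by linarith
    qed
  qed
  have b2: "1 / 2 ^ k \<le> b k / 2 ^ h" for k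
  proof -
    have "(2::real) ^ h \<le> 2 ^ (h - k) * 2 ^ k"
      unfolding power_add[symmetric] by (rule power_increasing) auto
    also have "\<dots> \<le> b k * 2 ^ k" by (intro mult_right_mono) (auto simp: b_def)
    finally show ?thesis by (simp add: field_simps)
  qed
  have prod_b: "prod b {0..<j} = 2 ^ l * 2 ^ (Suc h choose 2)"
  proof -
    have "{..<j} \<inter> {k. k < l} = {..<l}" using assms(1,2) by auto
    then have "(\<Prod>k<j. if k < l then 2 else 1 :: real) = 2 ^ l" by (simp add: prod.If_cases)
    then show ?thesis
      using prod_power_diff[OF assms(2)] by (simp add: b_def prod.distrib atLeast0LessThan)
  qed
  let ?P = "2 ^ l * (2::real) ^ (Suc h choose 2)"
  have p1: "\<bar>poly p v\<bar> \<le> ?P" and p2: "\<bar>poly (pderiv p) v\<bar> \<le> real j / 2 ^ h * ?P"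
    using factor_poly_bounds[of "{0..<j}" "2 ^ h" v b] b1 b2 by (simp_all add: prod_b p_def)
  have v: "2 ^ h \<le> v" by (simp add: v_def)
  have "\<bar>poly p v\<bar> / v\<^sup>2 \<le> ?P / (2 ^ h)\<^sup>2"
    using p1 v by (intro frac_le power_mono) auto
  moreover have "\<bar>poly (pderiv p) v\<bar> / v \<le> (real j / 2 ^ h * ?P) / 2 ^ h"
    using p2 v by (intro frac_le) auto
  ultimately have "\<bar>poly p v\<bar> / v\<^sup>2 + \<bar>poly (pderiv p) v\<bar> / v
      \<le> ?P / (2 ^ h)\<^sup>2 + (real j / 2 ^ h * ?P) / 2 ^ h" by (rule add_mono)
  also have "\<dots> = (real j + 1) * ?P / 4 ^ h"
    by (simp add: four_power power2_eq_square field_simps)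
  finally have sum_le: "\<bar>poly p v\<bar> / v\<^sup>2 + \<bar>poly (pderiv p) v\<bar> / v \<le> (real j + 1) * ?P / 4 ^ h" .
  have "\<bar>c\<bar> \<le> (4 ^ h * (1 / Q_inf ^ 2 / 2 ^ (h choose 2))) * (4 ^ l * (1 / Q_inf ^ 2 / 2 ^ (l choose 2)))"
    unfolding c_def abs_mult
    by (intro mult_mono mult_nonneg_nonneg hypoexp_coeff_bound) auto
  then have "\<bar>c\<bar> * (\<bar>poly p v\<bar> / v\<^sup>2 + \<bar>poly (pderiv p) v\<bar> / v)
     \<le> (4 ^ h * (1 / Q_inf ^ 2 / 2 ^ (h choose 2))) * (4 ^ l * (1 / Q_inf ^ 2 / 2 ^ (l choose 2)))
        * ((real j + 1) * ?P / 4 ^ h)"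
    using sum_le v by (intro mult_mono mult_nonneg_nonneg) (auto simp: v_def)
  also have "\<dots> = (8 ^ l / 2 ^ (l choose 2)) * (1 / Q_inf ^ 4 * (real j + 1)) * 2 ^ h"
  proof -
    have "(8::real) ^ l = 4 ^ l * 2 ^ l" by (simp flip: power_mult_distrib)
    moreover have "Q_inf ^ 4 = Q_inf ^ 2 * Q_inf ^ 2" by (simp flip: power_add)
    ultimately show ?thesis by (simp add: choose_two_Suc power_add field_simps)
  qed
  also have "\<dots> \<le> 64 * (1 / Q_inf ^ 4 * (real j + 1)) * 2 ^ j"
    using eight_power_le[of l] assms(2) Q_inf_pos
    by (intro mult_mono mult_right_mono power_increasing) (auto simp: field_simps)
  finally show ?thesis by simp
qed

lemma integral_affine_exp_le:
  fixes A B v x :: real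
  assumes "0 \<le> A" "0 \<le> B" "0 < v" "0 \<le> x"
  shows "integral {0..x} (\<lambda>t. (A * t + B) * exp (- v * t)) \<le> A / v\<^sup>2 + B / v"
proof -
  let ?\<Phi> = "\<lambda>t. - ((A * t + B) / v + A / v\<^sup>2) * exp (- v * t)"
  have "(?\<Phi> has_real_derivative (A * t + B) * exp (- v * t)) (at t within {0..x})" for t
    using assms(3) by (auto intro!: derivative_eq_intros simp: field_simps power2_eq_square)
  then have "((\<lambda>t. (A * t + B) * exp (- v * t)) has_integral ?\<Phi> x - ?\<Phi> 0) {0..x}"
    using assms(4) by (intro fundamental_theorem_of_calculus)
      (auto simp flip: has_real_derivative_iff_has_vector_derivative)
  then have "integral {0..x} (\<lambda>t. (A * t + B) * exp (- v * t)) = ?\<Phi> x - ?\<Phi> 0"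
    by (rule integral_unique)
  moreover have "0 \<le> (A * x + B) / v + A / v\<^sup>2" using assms by simp
  then have "?\<Phi> x \<le> 0" by (intro mult_nonpos_nonneg) auto
  ultimately show ?thesis by simp
qed

lemma integral_abs_source_le:
  "integral {0..x} (\<lambda>t. \<bar>source j 0 t\<bar>) \<le> 64 / Q_inf ^ 4 * (real j + 1) ^ 3 * 2 ^ j"
proof (cases "0 \<le> x")
  case False
  then show ?thesis using Q_inf_pos by simp
next
  case True
  define C where "C = 64 / Q_inf ^ 4 * (real j + 1) * 2 ^ j"
  define c where "c h l = 4 ^ h * hypoexp_coeff j h * (4 ^ l * hypoexp_coeff j l)" for h l
  define v :: "nat \<Rightarrow> nat \<Rightarrow> real" where "v h l = 2 ^ h + 2 ^ l" for h l
  let ?p = "factor_poly {0..<j}"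
  let ?A = "\<lambda>h l. \<bar>c h l\<bar> * \<bar>poly ?p (v h l)\<bar>" let ?B = "\<lambda>h l. \<bar>c h l\<bar> * \<bar>poly (pderiv ?p) (v h l)\<bar>"
  let ?g = "\<lambda>h l t. (?A h l * t + ?B h l) * exp (- v h l * t)"
  have v: "0 < v h l" for h l by (simp add: v_def add_pos_pos)
  have "integral {0..x} (\<lambda>t. \<bar>source j 0 t\<bar>) \<le> integral {0..x} (\<lambda>t. \<Sum>h\<le>j. \<Sum>l\<le>j. ?g h l t)"
  proof (rule integral_le)
    fix t assume t: "t \<in> {0..x}"
    have term_le: "\<bar>c h l * ((poly ?p (v h l) * t - poly (pderiv ?p) (v h l)) * exp (- v h l * t))\<bar> \<le> ?g h l t"
      for h l
    proof -
      have "\<bar>c h l\<bar> * \<bar>poly ?p (v h l) * t - poly (pderiv ?p) (v h l)\<bar>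
          \<le> \<bar>c h l\<bar> * (\<bar>poly ?p (v h l)\<bar> * t + \<bar>poly (pderiv ?p) (v h l)\<bar>)"
        using t abs_triangle_ineq4[of "poly ?p (v h l) * t" "poly (pderiv ?p) (v h l)"]
        by (intro mult_left_mono) (auto simp: abs_mult)
      then have "\<bar>c h l\<bar> * \<bar>poly ?p (v h l) * t - poly (pderiv ?p) (v h l)\<bar> * exp (- v h l * t)
          \<le> \<bar>c h l\<bar> * (\<bar>poly ?p (v h l)\<bar> * t + \<bar>poly (pderiv ?p) (v h l)\<bar>) * exp (- v h l * t)"
        by (rule mult_right_mono) simp
      moreover have "\<bar>c h l * (y * exp (- v h l * t))\<bar> = \<bar>c h l\<bar> * \<bar>y\<bar> * exp (- v h l * t)" for y
        by (simp add: abs_mult)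
      moreover have "\<bar>c h l\<bar> * (\<bar>poly ?p (v h l)\<bar> * t + \<bar>poly (pderiv ?p) (v h l)\<bar>)
          = ?A h l * t + ?B h l" by (simp add: distrib_left)
      ultimately show ?thesis by simp
    qed
    show "\<bar>source j 0 t\<bar> \<le> (\<Sum>h\<le>j. \<Sum>l\<le>j. ?g h l t)"
      unfolding source_def c_def[symmetric] v_def[symmetric]
      by (rule order.trans[OF sum_abs], rule sum_mono, rule order.trans[OF sum_abs], rule sum_mono)
         (rule term_le)
  qed (auto intro!: integrable_continuous_real continuous_intros)
  also have "\<dots> = (\<Sum>h\<le>j. \<Sum>l\<le>j. integral {0..x} (?g h l))"
    by (subst integral_sum)
       (auto intro!: sum.cong integral_sum integrable_continuous_real continuous_intros)
  also have "\<dots> \<le> (\<Sum>h\<le>j. \<Sum>l\<le>j. C)"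
  proof (intro sum_mono)
    fix h l assume "h \<in> {..j}" "l \<in> {..j}"
    then have hl: "h \<le> j" "l \<le> j" by auto
    have "integral {0..x} (?g h l) \<le> ?A h l / (v h l)\<^sup>2 + ?B h l / v h l"
      using True v by (intro integral_affine_exp_le) auto
    also have "\<dots> = \<bar>c h l\<bar> * (\<bar>poly ?p (v h l)\<bar> / (v h l)\<^sup>2 + \<bar>poly (pderiv ?p) (v h l)\<bar> / v h l)"
      by (simp add: distrib_left)
    also have "\<dots> \<le> C"
    proof (cases "l \<le> h")
      case True
      then show ?thesis using source_coeff_bounds[OF True hl(1)] by (simp add: c_def v_def C_def)
    next
      case False
      then have "h \<le> l" by simp
      from source_coeff_bounds[OF this hl(2)] show ?thesis
        by (simp add: c_def v_def C_def add.commute mult_ac)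
    qed
    finally show "integral {0..x} (?g h l) \<le> C" .
  qed
  also have "\<dots> = 64 / Q_inf ^ 4 * (real j + 1) ^ 3 * 2 ^ j"
    by (simp add: C_def power3_eq_cube algebra_simps add_divide_distrib)
  finally show ?thesis .
qed

text \<open>
  The kernel \<open>R\<^sub>j\<close> of the correction \<open>F * R\<^sub>j\<close>.
\<close>

definition corr_kernel :: "nat \<Rightarrow> real \<Rightarrow> real" where
  "corr_kernel j t = source j 0 t / 4 ^ j"

definition kernel_bound :: "nat \<Rightarrow> real" where
  "kernel_bound j = 64 / Q_inf ^ 4 * ((real j + 1) ^ 3 / 2 ^ j)"

lemma continuous_on_corr_kernel [continuous_intros]:
  "continuous_on A f \<Longrightarrow> continuous_on A (\<lambda>x. corr_kernel j (f x))"
  unfolding corr_kernel_def by (intro continuous_intros) auto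

lemma integral_abs_kernel_le: "integral {0..x} (\<lambda>t. \<bar>corr_kernel j t\<bar>) \<le> kernel_bound j"
proof -
  have "integral {0..x} (\<lambda>t. \<bar>source j 0 t\<bar>) / 4 ^ j
      \<le> 64 / Q_inf ^ 4 * (real j + 1) ^ 3 * 2 ^ j / 4 ^ j"
    by (intro divide_right_mono integral_abs_source_le) auto
  also have "\<dots> = kernel_bound j"
    by (simp add: kernel_bound_def four_power power2_eq_square)
  finally show ?thesis by (simp add: corr_kernel_def)
qed

lemma norm_kernel_mass_le: "norm (integral {0..x} (\<lambda>t. \<bar>corr_kernel j t\<bar>)) \<le> kernel_bound j"
proof -
  have "0 \<le> integral {0..x} (\<lambda>t. \<bar>corr_kernel j t\<bar>)"
    by (intro integral_nonneg integrable_continuous_real continuous_intros) auto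
  then show ?thesis using integral_abs_kernel_le[of x j] by simp
qed

lemma summable_kernel_bound: "summable kernel_bound"
proof -
  have "summable (\<lambda>j. (real j + 1) ^ 3 / 2 ^ j)"
  proof (rule summable_ratio_test[where c = "3/4" and N = 7])
    fix n :: nat assume n: "7 \<le> n"
    define m where "m = real n + 1"
    have m: "8 \<le> m" using n by (simp add: m_def)
    have "8 * (m * m) \<le> m * (m * m)" "8 * m \<le> m * m" using m by (auto intro: mult_right_mono)
    moreover have "2 * (m + 1) ^ 3 = 2 * (m * (m * m)) + 6 * (m * m) + 6 * m + 2"
      "3 * m ^ 3 = 3 * (m * (m * m))" by (simp_all add: power3_eq_cube algebra_simps)
    ultimately have "2 * (m + 1) ^ 3 \<le> 3 * m ^ 3" using m by linarith
    then show "norm ((real (Suc n) + 1) ^ 3 / 2 ^ Suc n) \<le> 3 / 4 * norm ((real n + 1) ^ 3 / 2 ^ n)"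
      by (simp add: m_def field_simps)
  qed simp
  then show ?thesis unfolding kernel_bound_def by (rule summable_mult)
qed

text \<open>
  The \<open>m\<close>-th derivative of \<open>F * R\<^sub>j\<close>. Since \<open>F_ext m\<close> vanishes on the negative axis, the upper limit \<open>x\<close> of the
  convolution may be replaced by \<open>1\<close> when \<open>x \<le> 1\<close>; with fixed limits, differentiation under the integral sign applies
  directly.
\<close>

definition correction :: "nat \<Rightarrow> nat \<Rightarrow> real \<Rightarrow> real" where
  "correction m j x = integral {0..1} (\<lambda>t. F_ext m (x - t) * corr_kernel j t)"

lemma correction_has_derivative:
  "(correction m j has_real_derivative correction (Suc m) j x) (at x)"
proof -
  have "((\<lambda>x. integral (cbox 0 1) (\<lambda>t. F_ext m (x - t) * corr_kernel j t)) has_real_derivative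
      integral (cbox 0 1) (\<lambda>t. F_ext (Suc m) (x - t) * corr_kernel j t)) (at x within UNIV)"
  proof (rule leibniz_rule_field_derivative)
    fix y t :: real
    have "((\<lambda>x. F_ext m (x - t)) has_real_derivative F_ext (Suc m) (y - t) * 1) (at y)"
      by (rule DERIV_chain2[OF F_ext_has_derivative]) (auto intro!: derivative_eq_intros)
    then show "((\<lambda>x. F_ext m (x - t) * corr_kernel j t) has_real_derivative
        F_ext (Suc m) (y - t) * corr_kernel j t) (at y within UNIV)"
      by (auto intro: DERIV_cmult_right simp del: F_ext.simps)
  qed (auto intro!: integrable_continuous_real continuous_intros simp: split_def simp del: F_ext.simps)
  then show ?thesis by (simp add: correction_def[abs_def] del: F_ext.simps)
qed

lemma correction_bounded:
  assumes "\<And>x. \<bar>F_ext m x\<bar> \<le> B"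
  shows "\<bar>correction m j x\<bar> \<le> B * kernel_bound j"
proof -
  have "norm (correction m j x) \<le> integral {0..1} (\<lambda>t. B * \<bar>corr_kernel j t\<bar>)"
    unfolding correction_def
    by (rule integral_norm_bound_integral)
       (auto intro!: integrable_continuous_real continuous_intros mult_right_mono assms
             simp: abs_mult simp del: F_ext.simps)
  also have "\<dots> \<le> B * kernel_bound j"
    using assms[of 0] integral_abs_kernel_le by (simp add: mult_left_mono)
  finally show ?thesis by simp
qed

lemma summable_correction: "summable (\<lambda>j. correction m j x)"
proof -
  obtain B where "\<And>x. \<bar>F_ext m x\<bar> \<le> B" using F_ext_bounded[of m] by blast
  then have "norm (correction m j x) \<le> B * kernel_bound j" for j
    unfolding real_norm_def by (rule correction_bounded)
  then show ?thesis
    by (intro summable_comparison_test'[OF summable_mult[OF summable_kernel_bound], of 0])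
qed

lemma suminf_correction_has_derivative:
  "((\<lambda>x. \<Sum>j. correction m j x) has_real_derivative (\<Sum>j. correction (Suc m) j x)) (at x)"
proof -
  obtain B where B: "\<And>x. \<bar>F_ext (Suc m) x\<bar> \<le> B" using F_ext_bounded[of "Suc m"] by blast
  have "uniformly_convergent_on UNIV (\<lambda>n x. \<Sum>j<n. correction (Suc m) j x)"
    by (rule Weierstrass_m_test'[OF _ summable_mult[OF summable_kernel_bound]])
       (unfold real_norm_def, rule correction_bounded[OF B])
  then show ?thesis
    using has_field_derivative_series'(2)[of UNIV "correction m" "correction (Suc m)" 0 x]
      correction_has_derivative summable_correction[of m 0] by auto
qed

lemma correction_eq_integral:
  assumes "0 \<le> x" "x \<le> 1"
  shows "correction m j x = integral {0..x} (\<lambda>t. F_ext m (x - t) * corr_kernel j t)"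
proof -
  let ?f = "\<lambda>t. F_ext m (x - t) * corr_kernel j t"
  have "?f integrable_on {0..1}"
    by (intro integrable_continuous_real continuous_intros)
  moreover have "integral {x..1} ?f = integral {x..1} (\<lambda>_. 0)"
    by (rule integral_cong) simp
  ultimately show ?thesis
    unfolding correction_def using Henstock_Kurzweil_Integration.integral_combine[OF assms, of ?f] by simp
qed

text \<open>
  Monotonicity of \<open>F\<^sup>(\<^sup>m\<^sup>)\<close> near the origin allows \<open>F\<^sup>(\<^sup>m\<^sup>) x\<close> to be taken out of the convolution.
\<close>

lemma correction_le:
  assumes mono: "\<And>y. y \<le> x \<Longrightarrow> 0 \<le> F_ext m y \<and> F_ext m y \<le> F_ext m x" and "0 \<le> x" "x \<le> 1"
  shows "\<bar>correction m j x\<bar> \<le> F_ext m x * integral {0..x} (\<lambda>t. \<bar>corr_kernel j t\<bar>)"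
proof -
  have int: "(\<lambda>t. F_ext m (x - t) * corr_kernel j t) integrable_on {0..x}"
    by (intro integrable_continuous_real continuous_intros)
  have "correction m j x = integral {0..x} (\<lambda>t. F_ext m (x - t) * corr_kernel j t)"
    using assms(2,3) by (rule correction_eq_integral)
  also have "norm \<dots> \<le> integral {0..x} (\<lambda>t. F_ext m x * \<bar>corr_kernel j t\<bar>)"
    using mono by (intro integral_norm_bound_integral int)
      (auto intro!: integrable_continuous_real continuous_intros mult_right_mono
            simp: abs_mult simp del: F_ext.simps)
  finally show ?thesis by simp
qed

text \<open>
  Each integral tends to \<open>0\<close>, and the summable \<open>L\<^sup>1\<close> bounds allow the limit to be exchanged with the sum
  (Tannery's theorem).
\<close>

lemma kernel_mass_tendsto_0:
  "((\<lambda>x. \<Sum>j. integral {0..x} (\<lambda>t. \<bar>corr_kernel j t\<bar>)) \<longlongrightarrow> 0) (at_right 0)"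
proof -
  let ?\<omega> = "\<lambda>j x. integral {0..x} (\<lambda>t. \<bar>corr_kernel j t\<bar>)"
  have "(?\<omega> j \<longlongrightarrow> 0) (at_right 0)" for j
  proof -
    have "continuous_on {0..1} (?\<omega> j)"
      by (intro indefinite_integral_continuous_1 integrable_continuous_real continuous_intros)
    from continuous_on_Icc_at_rightD[OF this] show ?thesis by simp
  qed
  moreover have "norm (?\<omega> j x) \<le> kernel_bound j" for j x
    by (rule norm_kernel_mass_le)
  ultimately have "((\<lambda>x. \<Sum>j. ?\<omega> j x) \<longlongrightarrow> (\<Sum>j. 0)) (at_right 0)"
    by (intro tannerys_theorem[of ?\<omega> "\<lambda>_. 0" "at_right 0" kernel_bound, THEN conjunct2, THEN conjunct2]
          always_eventually summable_kernel_bound) auto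
  then show ?thesis by simp
qed

lemma summable_kernel_mass: "summable (\<lambda>j. integral {0..x} (\<lambda>t. \<bar>corr_kernel j t\<bar>))"
proof (rule summable_comparison_test'[OF summable_kernel_bound, of 0])
  show "norm (integral {0..x} (\<lambda>t. \<bar>corr_kernel j t\<bar>)) \<le> kernel_bound j" for j
    by (rule norm_kernel_mass_le)
qed

lemma suminf_correction_smallo:
  "(\<lambda>x. \<Sum>j. correction m j x) \<in> o[at_right 0](F_ext m)"
proof (rule landau_o.smallI)
  fix c :: real assume "0 < c"
  obtain \<delta> where \<delta>: "0 < \<delta>" "\<And>x y. y \<le> \<delta> \<Longrightarrow> x \<le> y \<Longrightarrow> 0 \<le> F_ext m x \<and> F_ext m x \<le> F_ext m y"
    using F_ext_mono_near_0[of m] by blast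
  let ?\<omega> = "\<lambda>j x. integral {0..x} (\<lambda>t. \<bar>corr_kernel j t\<bar>)"
  have "eventually (\<lambda>x. (\<Sum>j. ?\<omega> j x) < c) (at_right 0)"
    using kernel_mass_tendsto_0 \<open>0 < c\<close> by (rule order_tendstoD)
  moreover have "eventually (\<lambda>x. x \<in> {0<..<min \<delta> 1}) (at_right 0)"
    by (rule eventually_at_right_real) (use \<delta>(1) in auto)
  ultimately show "eventually (\<lambda>x. norm (\<Sum>j. correction m j x) \<le> c * norm (F_ext m x)) (at_right 0)"
  proof eventually_elim
    case (elim x)
    then have x: "0 < x" "x \<le> \<delta>" "x \<le> 1" by auto
    have "norm (\<Sum>j. correction m j x) \<le> (\<Sum>j. F_ext m x * ?\<omega> j x)"
    proof (rule norm_suminf_le)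
      show "norm (correction m j x) \<le> F_ext m x * ?\<omega> j x" for j
        using correction_le[of x m j] \<delta>(2)[OF x(2)] x by simp
    qed (intro summable_mult summable_kernel_mass)
    also have "\<dots> = F_ext m x * (\<Sum>j. ?\<omega> j x)" by (rule suminf_mult[OF summable_kernel_mass])
    also have "\<dots> \<le> F_ext m x * c" using elim(1) \<delta>(2)[OF x(2), of x] by (intro mult_left_mono) auto
    finally show ?case using \<delta>(2)[OF x(2), of x] by (simp add: mult.commute)
  qed
qed

section \<open>The series for G\<close>

lemma phi_eq_convolution:
  assumes "0 \<le> x"
  shows "phi u v x = integral {0..x} (\<lambda>t. exp (- u * (x - t)) * (t * exp (- v * t)))"
proof -
  let ?f = "\<lambda>t. exp (- u * (x - t)) * (t * exp (- v * t))"
  have "(?f has_integral integral {0..x} ?f) (cbox 0 x)"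
    unfolding cbox_interval by (intro integrable_integral integrable_continuous_real continuous_intros)
  from has_integral_affinity[OF this, of "-1" x]
  have "((\<lambda>t. ?f (x - t)) has_integral integral {0..x} ?f) {0..x}"
    using assms by (simp add: image_affinity_atLeastAtMost_diff)
  moreover have "?f (x - t) = exp (- v * x) * ((x - t) * exp (- (u - v) * t))" for t
  proof -
    have "exp (- u * (x - (x - t))) * exp (- v * (x - t)) = exp (- v * x) * exp (- (u - v) * t)"
      unfolding exp_add[symmetric] by (simp add: algebra_simps)
    then show ?thesis by (simp add: mult_ac)
  qed
  ultimately have "((\<lambda>t. exp (- v * x) * ((x - t) * exp (- (u - v) * t)))
      has_integral integral {0..x} ?f) {0..x}" by (simp only:)
  from integral_unique[OF this] show ?thesis unfolding phi_def integral_mult_right .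
qed

lemma source_top:
  "source j j t = (\<Sum>h\<le>j. \<Sum>l\<le>j. 4 ^ h * hypoexp_coeff j h * (4 ^ l * hypoexp_coeff j l) *
     (t * exp (- (2 ^ h + 2 ^ l) * t)))"
  by (simp add: source_def factor_poly_def pderiv_1)

lemma integral_double_sum:
  fixes f :: "nat \<Rightarrow> nat \<Rightarrow> real \<Rightarrow> real"
  assumes "\<And>h l. f h l integrable_on S"
  shows "integral S (\<lambda>t. \<Sum>h\<le>j. \<Sum>l\<le>j. f h l t) = (\<Sum>h\<le>j. \<Sum>l\<le>j. integral S (f h l))"
  using assms by (simp add: integral_sum integrable_sum)

text \<open>
  The summand of \<open>G\<close> for fixed \<open>j\<close> and \<open>r\<close> after the sums over \<open>h\<close> and \<open>l\<close> are collected into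
  \<open>t (g\<^sub>j'' t)\<^sup>2 = source j j t\<close>.
\<close>

definition G_term :: "real \<Rightarrow> nat \<Rightarrow> nat \<Rightarrow> real" where
  "G_term x j r = F_coeff r / 2 ^ j *
     integral {0..x} (\<lambda>t. exp (- (2 ^ (j + r)) * (x - t)) * source j j t)"

lemma G_summand_eq:
  assumes "0 \<le> x"
  shows "(\<Sum>h\<le>j. \<Sum>l\<le>j.
     (- 1) ^ (r + h + l)
     * 2 powr (- real j - real (r choose 2) - real (h choose 2) - real (l choose 2)
                + 2 * real h + 2 * real l)
     / (Q_inf * Q r * Q h * Q (j - h) * Q l * Q (j - l))
     * phi (2 ^ (j + r)) (2 ^ h + 2 ^ l) x) = G_term x j r"
proof -
  let ?c = "\<lambda>h. 4 ^ h * hypoexp_coeff j h"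
  let ?e = "\<lambda>h l t. exp (- (2 ^ (j + r)) * (x - t)) * (t * exp (- (2 ^ h + 2 ^ l) * t))"
  have coeff: "(- 1) ^ (r + h + l)
     * 2 powr (- real j - real (r choose 2) - real (h choose 2) - real (l choose 2)
                + 2 * real h + 2 * real l)
     / (Q_inf * Q r * Q h * Q (j - h) * Q l * Q (j - l)) = F_coeff r / 2 ^ j * (?c h * ?c l)" for h l
  proof -
    have four: "2 powr (2 * real n) = 4 ^ n" for n
      by (simp add: powr_powr[symmetric] powr_realpow)
    have "2 powr (- real j - real (r choose 2) - real (h choose 2) - real (l choose 2)
        + 2 * real h + 2 * real l)
      = 4 ^ h * 4 ^ l / (2 ^ j * 2 ^ (r choose 2) * 2 ^ (h choose 2) * 2 ^ (l choose 2))"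
      unfolding powr_add powr_diff powr_minus four by (simp add: powr_realpow field_simps)
    then show ?thesis
      by (simp add: F_coeff_def hypoexp_coeff_def power_add mult_ac)
  qed
  have "G_term x j r = F_coeff r / 2 ^ j * integral {0..x} (\<lambda>t. \<Sum>h\<le>j. \<Sum>l\<le>j. ?c h * ?c l * ?e h l t)"
    unfolding G_term_def source_top sum_distrib_left by (simp add: mult_ac)
  also have "\<dots> = F_coeff r / 2 ^ j * (\<Sum>h\<le>j. \<Sum>l\<le>j. integral {0..x} (\<lambda>t. ?c h * ?c l * ?e h l t))"
    by (intro arg_cong2[where f = "(*)"] refl integral_double_sum)
       (intro integrable_continuous_real continuous_intros)
  also have "\<dots> = (\<Sum>h\<le>j. \<Sum>l\<le>j. F_coeff r / 2 ^ j * (?c h * ?c l) * phi (2 ^ (j + r)) (2 ^ h + 2 ^ l) x)"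
    unfolding phi_eq_convolution[OF assms] integral_mult_right sum_distrib_left
    by (simp only: mult.assoc)
  finally show ?thesis by (simp only: coeff)
qed

lemma abs_source_top_le:
  assumes "0 \<le> t" "t \<le> x"
  shows "\<bar>source j j t\<bar> \<le> 64 * x * (kernel_bound j * 2 ^ j)"
proof -
  have c: "\<bar>4 ^ h * hypoexp_coeff j h\<bar> \<le> 64 / Q_inf ^ 2" for h
  proof -
    have "(4::real) ^ h \<le> 8 ^ h" by (rule power_mono) auto
    then have "(4::real) ^ h \<le> 64 * 2 ^ (h choose 2)" using eight_power_le[of h] by linarith
    then have "4 ^ h * \<bar>hypoexp_coeff j h\<bar> \<le> 64 * 2 ^ (h choose 2) * (1 / Q_inf ^ 2 / 2 ^ (h choose 2))"
      by (intro mult_mono hypoexp_coeff_bound) auto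
    then show ?thesis by (simp add: abs_mult)
  qed
  have term_le: "\<bar>4 ^ h * hypoexp_coeff j h * (4 ^ l * hypoexp_coeff j l) * (t * exp (- (2 ^ h + 2 ^ l) * t))\<bar>
      \<le> 64 / Q_inf ^ 2 * (64 / Q_inf ^ 2) * x" for h l
  proof -
    have "\<bar>t * exp (- (2 ^ h + 2 ^ l) * t)\<bar> \<le> \<bar>t\<bar>"
      using assms(1) by (intro abs_mult_exp_le) auto
    then have "\<bar>t * exp (- (2 ^ h + 2 ^ l) * t)\<bar> \<le> x" using assms by linarith
    then show ?thesis
      unfolding abs_mult[of "_ * _ * (_ * _)"] abs_mult[of "4 ^ h * hypoexp_coeff j h"]
      using c[of h] c[of l] by (intro mult_mono mult_nonneg_nonneg) auto
  qed
  have "\<bar>source j j t\<bar> \<le> (\<Sum>h\<le>j. \<Sum>l\<le>j. 64 / Q_inf ^ 2 * (64 / Q_inf ^ 2) * x)"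
    unfolding source_top
    by (rule order.trans[OF sum_abs], rule sum_mono, rule order.trans[OF sum_abs], rule sum_mono)
       (rule term_le)
  also have "\<dots> = 64 * x * (64 / Q_inf ^ 4) * (real j + 1) ^ 2"
    by (simp add: power2_eq_square power4_eq_xxxx algebra_simps add_divide_distrib)
  also have "\<dots> \<le> 64 * x * (64 / Q_inf ^ 4) * (real j + 1) ^ 3"
    using assms by (intro mult_left_mono power_increasing) auto
  also have "\<dots> = 64 * x * (kernel_bound j * 2 ^ j)"
    by (simp add: kernel_bound_def)
  finally show ?thesis .
qed

lemma abs_G_term_le:
  assumes "0 \<le> x"
  shows "\<bar>G_term x j r\<bar> \<le> 64 * x\<^sup>2 * kernel_bound j * \<bar>F_coeff r\<bar>"
proof -
  have "norm (integral {0..x} (\<lambda>t. exp (- (2 ^ (j + r)) * (x - t)) * source j j t))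
      \<le> integral {0..x} (\<lambda>_. 64 * x * (kernel_bound j * 2 ^ j))"
  proof (rule integral_norm_bound_integral)
    fix t assume t: "t \<in> {0..x}"
    have "\<bar>source j j t * exp (- (2 ^ (j + r)) * (x - t))\<bar> \<le> \<bar>source j j t\<bar>"
      using t by (intro abs_mult_exp_le) auto
    also have "\<dots> \<le> 64 * x * (kernel_bound j * 2 ^ j)" using t by (intro abs_source_top_le) auto
    finally show "norm (exp (- (2 ^ (j + r)) * (x - t)) * source j j t) \<le> 64 * x * (kernel_bound j * 2 ^ j)"
      by (simp add: mult.commute)
  qed (auto intro!: integrable_continuous_real continuous_intros)
  also have "\<dots> = 64 * x\<^sup>2 * kernel_bound j * 2 ^ j"
    using assms by (simp add: power2_eq_square)
  finally have "\<bar>F_coeff r\<bar> / 2 ^ j * norm (integral {0..x} (\<lambda>t. exp (- (2 ^ (j + r)) * (x - t)) * source j j t))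
     \<le> \<bar>F_coeff r\<bar> / 2 ^ j * (64 * x\<^sup>2 * kernel_bound j * 2 ^ j)"
    by (rule mult_left_mono) simp
  then show ?thesis by (simp add: G_term_def abs_mult mult_ac)
qed

lemma kernel_bound_nonneg: "0 \<le> kernel_bound j"
  using Q_inf_pos by (simp add: kernel_bound_def)

lemma summable_on_product_real:
  fixes a b :: "nat \<Rightarrow> real"
  assumes "summable a" "summable b" "\<And>j. 0 \<le> a j" "\<And>r. 0 \<le> b r"
  shows "(\<lambda>(j, r). a j * b r) summable_on UNIV"
proof -
  have "a summable_on UNIV" "b summable_on UNIV"
    using assms by (auto intro!: norm_summable_imp_summable_on)
  then have "(\<lambda>(j, r). a j * b r) summable_on UNIV \<times> UNIV"
    using assms(3,4)
    by (intro summable_on_SigmaI[where g = "\<lambda>j. a j * infsum b UNIV"])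
       (auto intro: has_sum_cmult_right summable_on_cmult_left)
  then show ?thesis by simp
qed

lemma summable_G_term:
  assumes "0 \<le> x"
  shows "(\<lambda>(j, r). G_term x j r) summable_on UNIV" and "summable (\<lambda>r. norm (G_term x j r))"
proof -
  have "(\<lambda>(j, r). kernel_bound j * \<bar>F_coeff r\<bar>) summable_on UNIV"
    by (rule summable_on_product_real[OF summable_kernel_bound summable_F_coeff])
       (auto intro: kernel_bound_nonneg)
  from summable_on_cmult_right[OF this, of "64 * x\<^sup>2"]
  have "(\<lambda>(j, r). 64 * x\<^sup>2 * kernel_bound j * \<bar>F_coeff r\<bar>) summable_on UNIV"
    by (simp add: split_def mult.assoc)
  then have "(\<lambda>p. norm (case p of (j, r) \<Rightarrow> G_term x j r)) summable_on UNIV"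
    by (rule summable_on_comparison_test) (use abs_G_term_le[OF assms] in auto)
  then show "(\<lambda>(j, r). G_term x j r) summable_on UNIV" by (rule abs_summable_summable)
  show "summable (\<lambda>r. norm (G_term x j r))"
    by (rule summable_comparison_test'[OF summable_mult[OF summable_F_coeff], of 0])
       (use abs_G_term_le[OF assms] in auto)
qed

text \<open>
  The sum over \<open>r\<close> rebuilds \<open>F (2\<^sup>j (x - t))\<close> under the integral, that is, the convolution of \<open>K\<^sub>j\<close> with \<open>u\<^sub>j\<close>. For
  \<open>j = 2\<close> the boundary value \<open>32\<close> divided by \<open>4\<^sup>2\<close> gives the main term \<open>2 F x\<close>.
\<close>

lemma suminf_G_term:
  assumes "0 \<le> x" "x \<le> 1"
  shows "(\<Sum>r. G_term x j r) = correction 0 j x + (if j = 2 then 2 * F_ext 0 x else 0)"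
proof -
  let ?f = "\<lambda>r t. F_coeff r * (exp (- (2 ^ (j + r)) * (x - t)) * source j j t)"
  let ?g = "\<lambda>t. F_ext 0 (2 ^ j * (x - t)) * source j j t"
  define D where "D = 64 * x * (kernel_bound j * 2 ^ j)"
  have "uniform_limit {0..x} (\<lambda>n t. \<Sum>r<n. ?f r t) (\<lambda>t. \<Sum>r. ?f r t) sequentially"
  proof (rule Weierstrass_m_test[OF _ summable_mult2[OF summable_F_coeff, of D]])
    fix r t assume t: "t \<in> {0..x}"
    have "\<bar>F_coeff r * exp (- (2 ^ (j + r)) * (x - t))\<bar> * \<bar>source j j t\<bar> \<le> \<bar>F_coeff r\<bar> * D"
      unfolding D_def using t by (intro mult_mono abs_mult_exp_le abs_source_top_le) auto
    then show "norm (?f r t) \<le> \<bar>F_coeff r\<bar> * D" by (simp add: abs_mult mult.assoc)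
  qed
  moreover have "(\<Sum>r. ?f r t) = ?g t" if "t \<in> {0..x}" for t
  proof -
    have y: "0 \<le> 2 ^ j * (x - t)" using that by simp
    have "(\<Sum>r. ?f r t) = (\<Sum>r. F_coeff r * exp (- (2 ^ r) * (2 ^ j * (x - t))) * source j j t)"
      by (intro suminf_cong) (simp add: power_add mult_ac)
    also have "\<dots> = F (2 ^ j * (x - t)) * source j j t"
      unfolding F_eq by (rule suminf_mult2[symmetric, OF summable_F_term[OF y]])
    also have "F (2 ^ j * (x - t)) = F_ext 0 (2 ^ j * (x - t))"
      using y by (cases "2 ^ j * (x - t) = 0") auto
    finally show ?thesis .
  qed
  ultimately have "uniform_limit {0..x} (\<lambda>n t. \<Sum>r<n. ?f r t) ?g sequentially"
    by (subst (asm) uniform_limit_cong') auto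
  then obtain I J where I: "\<And>n. ((\<lambda>t. \<Sum>r<n. ?f r t) has_integral I n) {0..x}"
      and J: "(?g has_integral J) {0..x}" and lim: "I \<longlonglongrightarrow> J"
    by (rule uniform_limit_integral) (auto intro!: continuous_intros)
  have I_eq: "I n = 2 ^ j * (\<Sum>r<n. G_term x j r)" for n
  proof -
    have "I n = (\<Sum>r<n. integral {0..x} (?f r))"
      unfolding integral_unique[OF I, symmetric]
      by (intro integral_sum) (auto intro!: integrable_continuous_real continuous_intros)
    then show ?thesis by (simp add: G_term_def sum_distrib_left)
  qed
  have "(\<lambda>n. 2 ^ j * (\<Sum>r<n. G_term x j r)) \<longlonglongrightarrow> J"
    using lim by (simp only: I_eq[abs_def])
  from tendsto_mult_left[OF this, of "1 / 2 ^ j"]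
  have "(\<lambda>n. \<Sum>r<n. G_term x j r) \<longlonglongrightarrow> J / 2 ^ j" by simp
  then have "(\<Sum>r. G_term x j r) = J / 2 ^ j"
    unfolding sums_def[symmetric] by (rule sums_unique[symmetric])
  also have "J / 2 ^ j = integral {0..x} (\<lambda>t. tail_density j (x - t) * source j j t) / 4 ^ j"
  proof -
    have "integral {0..x} (\<lambda>t. tail_density j (x - t) * source j j t) = 2 ^ j * J"
      unfolding tail_density_def mult.assoc integral_mult_right integral_unique[OF J] ..
    then show ?thesis by (simp add: four_power power2_eq_square)
  qed
  also have "\<dots> = (integral {0..x} (\<lambda>t. F_ext 0 (x - t) * source j 0 t)
      + (if j = 2 then 32 * F_ext 0 x else 0)) / 4 ^ j"
    unfolding convolution_shift[OF assms(1)] ..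
  also have "\<dots> = correction 0 j x + (if j = 2 then 2 * F_ext 0 x else 0)"
    unfolding correction_eq_integral[OF assms] corr_kernel_def
    by (simp add: add_divide_distrib del: F_ext.simps)
  finally show ?thesis .
qed

lemma G_eq:
  assumes "0 < x" "x \<le> 1"
  shows "G x = 2 * F x + (\<Sum>j. correction 0 j x)"
proof -
  have x: "0 \<le> x" using assms by simp
  have "G x = (\<Sum>\<^sub>\<infinity>(j, r)\<in>UNIV. G_term x j r)"
    unfolding G_def G_summand_eq[OF x] ..
  also have "\<dots> = (\<Sum>\<^sub>\<infinity>j. \<Sum>\<^sub>\<infinity>r. G_term x j r)"
    using infsum_Sigma'_banach[of "G_term x" UNIV "\<lambda>_. UNIV"] summable_G_term(1)[OF x] by simp
  also have "\<dots> = (\<Sum>\<^sub>\<infinity>j. \<Sum>r. G_term x j r)"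
  proof (intro infsum_cong infsumI norm_summable_imp_has_sum summable_G_term x)
    show "G_term x j sums (\<Sum>r. G_term x j r)" for j
      using summable_G_term(2)[OF x, of j] by (intro summable_sums) (rule summable_norm_cancel)
  qed
  also have "\<dots> = (\<Sum>\<^sub>\<infinity>j. correction 0 j x + (if j = 2 then 2 * F_ext 0 x else 0))"
    by (simp only: suminf_G_term[OF x assms(2)])
  also have "\<dots> = (\<Sum>j. correction 0 j x) + 2 * F_ext 0 x"
  proof (intro infsumI norm_summable_imp_has_sum)
    have single: "(\<lambda>j. if j = 2 then 2 * F_ext 0 x else 0) sums (2 * F_ext 0 x)"
      by (rule sums_single)
    show "(\<lambda>j. correction 0 j x + (if j = 2 then 2 * F_ext 0 x else 0)) sums ((\<Sum>j. correction 0 j x) + 2 * F_ext 0 x)"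
      by (intro sums_add single summable_sums summable_correction)
    obtain B where B: "\<And>x. \<bar>F_ext 0 x\<bar> \<le> B" using F_ext_bounded[of 0] by blast
    have "summable (\<lambda>j. B * kernel_bound j + (if j = 2 then \<bar>2 * F_ext 0 x\<bar> else 0))"
      by (intro summable_add summable_mult summable_kernel_bound sums_summable[OF sums_single])
    then show "summable (\<lambda>j. norm (correction 0 j x + (if j = 2 then 2 * F_ext 0 x else 0)))"
    proof (rule summable_comparison_test')
      show "norm (norm (correction 0 j x + (if j = 2 then 2 * F_ext 0 x else 0)))
          \<le> B * kernel_bound j + (if j = 2 then \<bar>2 * F_ext 0 x\<bar> else 0)" for j
        using correction_bounded[OF B, of j x] by (auto simp del: F_ext.simps)
    qed
  qed
  finally show ?thesis using assms by simp
qed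

lemma deriv_iterate_G:
  assumes "x \<in> {0<..<1}"
  shows "(deriv ^^ m) G x = 2 * F_ext m x + (\<Sum>j. correction m j x)"
proof (rule deriv_iterate_eq[of "{0<..<1}"])
  show "((\<lambda>x. 2 * F_ext m x + (\<Sum>j. correction m j x)) has_real_derivative
      2 * F_ext (Suc m) y + (\<Sum>j. correction (Suc m) j y)) (at y)" for m y
    by (intro DERIV_add DERIV_cmult F_ext_has_derivative suminf_correction_has_derivative)
qed (use assms G_eq in auto)

theorem proposition3:
  fixes m :: nat
  shows "(deriv ^^ m) G \<sim>[at_right 0] (\<lambda>x. 2 * (deriv ^^ m) F x)"
proof -
  have ev: "eventually (\<lambda>x::real. x \<in> {0<..<1}) (at_right 0)"
    by (rule eventually_at_right_real) simp
  have "(\<lambda>x. 2 * F_ext m x + (\<Sum>j. correction m j x)) \<sim>[at_right 0] (\<lambda>x. 2 * F_ext m x)"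
    using suminf_correction_smallo[of m] by (intro smallo_imp_asymp_equiv) (simp del: F_ext.simps)
  moreover have "eventually (\<lambda>x. 2 * F_ext m x + (\<Sum>j. correction m j x) = (deriv ^^ m) G x) (at_right 0)"
    using ev by eventually_elim (simp only: deriv_iterate_G)
  moreover have "eventually (\<lambda>x. 2 * F_ext m x = 2 * (deriv ^^ m) F x) (at_right 0)"
    using ev by eventually_elim (simp add: deriv_iterate_F del: F_ext.simps)
  ultimately show ?thesis by (rule asymp_equiv_transfer)
qed

end
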